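(* Let $\Omega\subset\mathbb{R}^N$ be a smooth bounded domain with $C^{1,1}$ boundary, $s\in(0,1)$, $p\in(1,\infty)$, $\gamma\ge 0$, $\delta\in[0,sp)$ with $0\le\delta<1+s-\frac1p$, and let $K_\delta$ satisfy $\mathcal{C}_1 d(x)^{-\delta}\le K_\delta(x)\le \mathcal{C}_2 d(x)^{-\delta}$ for all $x\in\Omega$, for some constants $\mathcal{C}_1,\mathcal{C}_2>0$. Let $u$ be a weak subsolution of $(P)$ and $\tilde v$ a weak supersolution of $(P)$. Then $u\le\tilde v$ a.e. in $\Omega$.
   Context: Here $d(x)=\operatorname{dist}(x,\partial\Omega)$ and $[t]^{p-1}:=|t|^{p-2}t$ for $t\in\mathbb{R}$. Problem $(P)$ is: $(-\Delta)^s_p u=\frac{K_\delta(x)}{u^\gamma}$, $u>0$ in $\Omega$, $u=0$ in $\mathbb{R}^N\setminus\Omega$, where $(-\Delta)^s_p u(x)=2\lim_{\epsilon\to0}\int_{\mathbb{R}^N\setminus B_\epsilon(x)}\frac{[u(x)-u(y)]^{p-1}}{|x-y|^{N+sp}}\,dy$. Function spaces: $W^{s,p}(\mathbb{R}^N)=\{u\in L^p(\mathbb{R}^N): [u]_{s,p}<\infty\}$ with $[u]_{s,p}^p=\iint_{\mathbb{R}^{2N}}\frac{|u(x)-u(y)|^p}{|x-y|^{N+sp}}dx\,dy$. For an open set $\omega$, $W^{s,p}_0(\omega)=\{u\in W^{s,p}(\mathbb{R}^N): u=0\text{ a.e. in }\mathbb{R}^N\setminus\omega\}$. $W^{s,p}_{loc}(\Omega)$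 is the set of $u:\Omega\to\mathbb{R}$ with $u\in L^p(\omega)$ and $\iint_{\omega\times\omega}\frac{|u(x)-u(y)|^p}{|x-y|^{N+sp}}dx\,dy<\infty$ for all $\omega\Subset\Omega$. Put $\mathbb{T}=\bigcup_{\tilde\Omega\Subset\Omega}W^{s,p}_0(\tilde\Omega)$. Weak sub/supersolution of $(P)$: a function $u\in W^{s,p}_{loc}(\Omega)$, extended by $0$ outside $\Omega$, such that $u^\kappa\in W^{s,p}_0(\Omega)$ for some $\kappa\ge1$, $\inf_K u>0$ for all $K\Subset\Omega$, and $$\iint_{\mathbb{R}^{2N}}\frac{[u(x)-u(y)]^{p-1}(\phi(x)-\phi(y))}{|x-y|^{N+sp}}dx\,dy\le(\text{resp. }\ge)\int_\Omega\frac{K_\delta(x)}{u^\gamma}\phi\,dx$$ for all $\phi\in\mathbb{T}$ with $\phi\ge0$. *)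

theory Defs
  imports "HOL-Analysis.Analysis"
begin

text \<open>Near each boundary point, \<open>\<Omega>\<close> is the strict epigraph of a \<open>C\<^sup>1\<^sup>,\<^sup>1\<close> function over the
  hyperplane orthogonal to a unit vector \<open>e\<close>. The function \<open>f\<close> lives on the whole space but is only
  evaluated on that hyperplane; any \<open>C\<^sup>1\<^sup>,\<^sup>1\<close> function on the hyperplane extends in this way by
  composition with the orthogonal projection.\<close>

definition C11_boundary :: "'a::euclidean_space set \<Rightarrow> bool" where
  "C11_boundary \<Omega> \<longleftrightarrow>
    (\<forall>x0\<in>frontier \<Omega>. \<exists>r>0. \<exists>e. \<exists>f :: 'a \<Rightarrow> real. \<exists>g :: 'a \<Rightarrow> 'a. \<exists>L.
       norm e = 1 \<and>
       (\<forall>y. (f has_derivative (\<lambda>h. g y \<bullet> h)) (at y)) \<and>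
       L-lipschitz_on UNIV g \<and>
       \<Omega> \<inter> ball x0 r = {y \<in> ball x0 r. f (y - (y \<bullet> e) *\<^sub>R e) < y \<bullet> e})"

definition bounded_C11_domain :: "'a::euclidean_space set \<Rightarrow> bool" where
  "bounded_C11_domain \<Omega> \<longleftrightarrow>
     \<Omega> \<noteq> {} \<and> open \<Omega> \<and> connected \<Omega> \<and> bounded \<Omega> \<and> C11_boundary \<Omega>"

definition compactly_contained :: "'a::euclidean_space set \<Rightarrow> 'a set \<Rightarrow> bool" where
  "compactly_contained A \<Omega> \<longleftrightarrow> compact (closure A) \<and> closure A \<subseteq> \<Omega>"

text \<open>The signed power \<open>[t]\<^sup>p\<^sup>-\<^sup>1 = |t|\<^sup>p\<^sup>-\<^sup>2 t\<close>; it vanishes at \<open>t = 0\<close> for every \<open>p\<close>, since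
  \<open>0 powr a = 0\<close>.\<close>

definition sgn_pow :: "real \<Rightarrow> real \<Rightarrow> real" where
  "sgn_pow p t = \<bar>t\<bar> powr (p - 2) * t"

text \<open>The kernel denominator is \<open>0\<close> on the diagonal, where division yields \<open>0\<close>; the diagonal is a
  null set of the product space.\<close>

definition gagliardo :: "real \<Rightarrow> real \<Rightarrow> 'a::euclidean_space set \<Rightarrow> ('a \<Rightarrow> real) \<Rightarrow> ennreal" where
  "gagliardo s p A u =
     (\<integral>\<^sup>+z\<in>A \<times> A. ennreal (\<bar>u (fst z) - u (snd z)\<bar> powr p /
        norm (fst z - snd z) powr (real DIM('a) + s * p)) \<partial>lebesgue)"

definition in_Lp :: "real \<Rightarrow> 'a::euclidean_space set \<Rightarrow> ('a \<Rightarrow> real) \<Rightarrow> bool" where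
  "in_Lp p A u \<longleftrightarrow>
     u \<in> borel_measurable (lebesgue_on A) \<and> integrable (lebesgue_on A) (\<lambda>x. \<bar>u x\<bar> powr p)"

definition W_sp :: "real \<Rightarrow> real \<Rightarrow> ('a::euclidean_space \<Rightarrow> real) set" where
  "W_sp s p = {u. in_Lp p UNIV u \<and> gagliardo s p UNIV u < \<infinity>}"

definition W_sp_0 :: "real \<Rightarrow> real \<Rightarrow> 'a::euclidean_space set \<Rightarrow> ('a \<Rightarrow> real) set" where
  "W_sp_0 s p A = {u \<in> W_sp s p. AE x in lebesgue. x \<notin> A \<longrightarrow> u x = 0}"

definition W_sp_loc :: "real \<Rightarrow> real \<Rightarrow> 'a::euclidean_space set \<Rightarrow> ('a \<Rightarrow> real) set" where
  "W_sp_loc s p \<Omega> =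
     {u. \<forall>A. open A \<and> compactly_contained A \<Omega> \<longrightarrow> in_Lp p A u \<and> gagliardo s p A u < \<infinity>}"

definition test_space :: "real \<Rightarrow> real \<Rightarrow> 'a::euclidean_space set \<Rightarrow> ('a \<Rightarrow> real) set" where
  "test_space s p \<Omega> = (\<Union>A\<in>{A. open A \<and> compactly_contained A \<Omega>}. W_sp_0 s p A)"

definition weak_form ::
  "real \<Rightarrow> real \<Rightarrow> ('a::euclidean_space \<Rightarrow> real) \<Rightarrow> ('a \<Rightarrow> real) \<Rightarrow> real" where
  "weak_form s p u \<phi> =
     (\<integral>z. sgn_pow p (u (fst z) - u (snd z)) * (\<phi> (fst z) - \<phi> (snd z)) /
        norm (fst z - snd z) powr (real DIM('a) + s * p) \<partial>lebesgue)"

definition singular_term ::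
  "'a::euclidean_space set \<Rightarrow> ('a \<Rightarrow> real) \<Rightarrow> real \<Rightarrow> ('a \<Rightarrow> real) \<Rightarrow> ('a \<Rightarrow> real) \<Rightarrow> real" where
  "singular_term \<Omega> K \<gamma> u \<phi> = (\<integral>x. K x / u x powr \<gamma> * \<phi> x \<partial>lebesgue_on \<Omega>)"

text \<open>The requirements shared by weak sub- and supersolutions. Functions on \<open>\<Omega>\<close> are
  represented by their extension by zero, and the infimum over \<open>A\<close> is an essential one, as the
  functions involved are determined only almost everywhere. On a bounded \<open>\<Omega>\<close> these conditions,
  together with measurability of \<open>K\<close> and its bound by a power of the boundary distance, make both
  integrands in the weak inequality absolutely integrable for every test function, so the Bochner
  integrals never take their default value.\<close>

definition admissible ::
  "real \<Rightarrow> real \<Rightarrow> 'a::euclidean_space set \<Rightarrow> ('a \<Rightarrow> real) \<Rightarrow> bool" where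
  "admissible s p \<Omega> u \<longleftrightarrow>
     u \<in> W_sp_loc s p \<Omega> \<and> (\<forall>x. x \<notin> \<Omega> \<longrightarrow> u x = 0) \<and>
     (\<exists>\<kappa>\<ge>1. (\<lambda>x. u x powr \<kappa>) \<in> W_sp_0 s p \<Omega>) \<and>
     (\<forall>A. compactly_contained A \<Omega> \<longrightarrow> (\<exists>c>0. AE x in lebesgue. x \<in> A \<longrightarrow> c \<le> u x))"

definition weak_subsolution ::
  "real \<Rightarrow> real \<Rightarrow> real \<Rightarrow> ('a::euclidean_space \<Rightarrow> real) \<Rightarrow> 'a set \<Rightarrow> ('a \<Rightarrow> real) \<Rightarrow> bool" where
  "weak_subsolution s p \<gamma> K \<Omega> u \<longleftrightarrow>
     admissible s p \<Omega> u \<and>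
     (\<forall>\<phi>\<in>test_space s p \<Omega>. (AE x in lebesgue. 0 \<le> \<phi> x) \<longrightarrow>
        weak_form s p u \<phi> \<le> singular_term \<Omega> K \<gamma> u \<phi>)"

definition weak_supersolution ::
  "real \<Rightarrow> real \<Rightarrow> real \<Rightarrow> ('a::euclidean_space \<Rightarrow> real) \<Rightarrow> 'a set \<Rightarrow> ('a \<Rightarrow> real) \<Rightarrow> bool" where
  "weak_supersolution s p \<gamma> K \<Omega> u \<longleftrightarrow>
     admissible s p \<Omega> u \<and>
     (\<forall>\<phi>\<in>test_space s p \<Omega>. (AE x in lebesgue. 0 \<le> \<phi> x) \<longrightarrow>
        weak_form s p u \<phi> \<ge> singular_term \<Omega> K \<gamma> u \<phi>)"

end

theory Submission
  imports Defs
begin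

text \<open>Fix \<open>\<epsilon> > 0\<close> and put \<open>\<psi> = (u - \<epsilon>)\<^sup>+\<close>, which lies in \<open>W\<^sup>s\<^sup>,\<^sup>p\<^sub>0(\<Omega>)\<close> because
  \<open>u\<^sup>\<kappa>\<close> does. The formal test function \<open>(\<psi> - v)\<^sup>+\<close> is neither compactly supported nor known to
  have finite energy. Compactness of the boundary yields a finite set \<open>E\<close> of
  directions containing \<open>0\<close> such that \<open>a\<^sub>t(x) = min {\<psi>(x - t e) | e \<in> E}\<close> has compact support in
  \<open>\<Omega>\<close> for all small \<open>t > 0\<close>, and then \<open>\<phi>\<^sub>t = (a\<^sub>t - v)\<^sup>+\<close> is an admissible test function. Since
  \<open>\<phi>\<^sub>t\<close> decreases in \<open>v\<close>, the difference of the two weak integrands is bounded below by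
  \<open>- 4 (|\<psi>(x) - \<psi>(y)|\<^sup>p + |a\<^sub>t(x) - a\<^sub>t(y)|\<^sup>p)\<close> times the kernel, in which \<open>v\<close> no longer appears.
  The last term is at most the sum of the energy densities of the translates of \<open>\<psi>\<close>, whose
  integral does not depend on \<open>t\<close>. Fatou's lemma therefore applies as \<open>t\<close> tends to \<open>0\<close>
  along a sequence on which the translates converge almost everywhere, and shows that the
  nonnegative limit integrand vanishes almost everywhere. By strict monotonicity
  \<open>(u - v - \<epsilon>)\<^sup>+\<close> is then constant, hence \<open>0\<close>.\<close>

section \<open>Lebesgue measure on products and translations\<close>

text \<open>Because \<open>lebesgue\<close> completes \<open>lborel\<close>, Borel measurability of
  a translation into \<open>lborel\<close> is not enough: preimages of null sets must be null as
  well. This follows because the pushforward of \<open>lebesgue\<close> to \<open>lborel\<close> is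
  \<open>lborel\<close> itself.\<close>

lemma distr_lebesgue_plus:
  fixes c :: "'a::euclidean_space"
  shows "(+) c \<in> lebesgue \<rightarrow>\<^sub>M lebesgue" "distr lebesgue lebesgue ((+) c) = lebesgue"
proof -
  have m: "(+) c \<in> lebesgue \<rightarrow>\<^sub>M lborel"
    by (simp add: measurable_completion)
  have "distr lborel lborel ((+) c) = distr lborel borel ((+) c)"
    by (rule distr_cong) auto
  then have d: "distr lebesgue lborel ((+) c) = lborel"
    by (subst distr_completion) (auto simp: lborel_distr_plus)
  show "(+) c \<in> lebesgue \<rightarrow>\<^sub>M lebesgue"
    by (rule completion.measurable_completion2[OF m]) (simp add: d)
  show "distr lebesgue lebesgue ((+) c) = lebesgue"
    using completion.completion_distr_eq[OF m] by (simp add: d)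
qed

lemma measurable_lebesgue_diff_const [measurable]:
  fixes c :: "'a::euclidean_space"
  shows "(\<lambda>x. x - c) \<in> lebesgue \<rightarrow>\<^sub>M lebesgue"
proof -
  have "(+) (- c) = (\<lambda>x. x - c)" by auto
  then show ?thesis using distr_lebesgue_plus(1)[of "- c"] by metis
qed

lemma translate_lebesgue_measurable:
  fixes f :: "'a::euclidean_space \<Rightarrow> 'b::topological_space"
  assumes [measurable]: "f \<in> borel_measurable lebesgue"
  shows "(\<lambda>x. f (x - c)) \<in> borel_measurable lebesgue"
  using measurable_comp[OF distr_lebesgue_plus(1)[of "- c"] assms] by (simp add: o_def)

lemma nn_integral_lebesgue_translate:
  fixes f :: "'a::euclidean_space \<Rightarrow> ennreal"
  assumes "f \<in> borel_measurable lebesgue"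
  shows "(\<integral>\<^sup>+x. f (x - c) \<partial>lebesgue) = (\<integral>\<^sup>+x. f x \<partial>lebesgue)"
  using nn_integral_distr[OF distr_lebesgue_plus(1)[of "- c"], of f] assms
  by (simp add: distr_lebesgue_plus(2))

section \<open>Null sets and integrals on the product space\<close>

lemma lborel_null_sets_Times_UNIV:
  fixes N :: "'a::euclidean_space set"
  assumes "N \<in> null_sets lborel"
  shows "N \<times> (UNIV::'b::euclidean_space set) \<in> null_sets lborel"
    "(UNIV::'b set) \<times> N \<in> null_sets lborel"
proof -
  have "N \<times> (UNIV :: 'b set) \<in> null_sets (lborel \<Otimes>\<^sub>M lborel)"
    "(UNIV :: 'b set) \<times> N \<in> null_sets (lborel \<Otimes>\<^sub>M lborel)"
    using assms by (auto intro: lborel.times_in_null_sets1 lborel.times_in_null_sets2)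
  then show "N \<times> (UNIV :: 'b set) \<in> null_sets lborel" "(UNIV :: 'b set) \<times> N \<in> null_sets lborel"
    by (simp_all add: lborel_prod)
qed

text \<open>A projection pulls a null set back to a cylinder over it, which is null in the product;
  this upgrades Borel measurability to measurability for the completed measures.\<close>

lemma measurable_lebesgue_fst_snd [measurable]:
  "fst \<in> (lebesgue :: ('a::euclidean_space \<times> 'b::euclidean_space) measure) \<rightarrow>\<^sub>M lebesgue"
  "snd \<in> (lebesgue :: ('a \<times> 'b) measure) \<rightarrow>\<^sub>M lebesgue"
proof -
  have m1: "fst \<in> (lebesgue :: ('a \<times> 'b) measure) \<rightarrow>\<^sub>M lborel"
    and m2: "snd \<in> (lebesgue :: ('a \<times> 'b) measure) \<rightarrow>\<^sub>M lborel"
    by (simp_all add: measurable_completion borel_prod[symmetric])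
  have "N \<in> null_sets (distr lebesgue lborel (fst :: 'a \<times> 'b \<Rightarrow> 'a))" if "N \<in> null_sets lborel" for N
  proof -
    have "fst -` N = N \<times> (UNIV :: 'b set)" by auto
    then show ?thesis
      using lborel_null_sets_Times_UNIV(1)[OF that, where 'b='b] that m1
      by (simp add: null_sets_def emeasure_distr)
  qed
  then show "fst \<in> (lebesgue :: ('a \<times> 'b) measure) \<rightarrow>\<^sub>M lebesgue"
    by (intro completion.measurable_completion2[OF m1]) auto
  have "N \<in> null_sets (distr lebesgue lborel (snd :: 'a \<times> 'b \<Rightarrow> 'b))" if "N \<in> null_sets lborel" for N
  proof -
    have "snd -` N = (UNIV :: 'a set) \<times> N" by auto
    then show ?thesis
      using lborel_null_sets_Times_UNIV(2)[OF that, where 'b='a] that m2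
      by (simp add: null_sets_def emeasure_distr)
  qed
  then show "snd \<in> (lebesgue :: ('a \<times> 'b) measure) \<rightarrow>\<^sub>M lebesgue"
    by (intro completion.measurable_completion2[OF m2]) auto
qed

lemma borel_measurable_lebesgue_fst_snd:
  fixes f :: "'a::euclidean_space \<Rightarrow> 'c::topological_space"
  assumes "f \<in> borel_measurable lebesgue"
  shows "(\<lambda>z :: 'a \<times> 'b::euclidean_space. f (fst z)) \<in> borel_measurable lebesgue"
    "(\<lambda>z :: 'b \<times> 'a. f (snd z)) \<in> borel_measurable lebesgue"
  using measurable_comp[OF measurable_lebesgue_fst_snd(1) assms]
    measurable_comp[OF measurable_lebesgue_fst_snd(2) assms] by (simp_all add: o_def)

text \<open>The exceptional pairs lie in two null cylinders over the exceptional points. Pointwise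
  facts about single functions thereby become facts about the double integrals.\<close>

lemma AE_lebesgue_fst_snd:
  assumes "AE x in (lebesgue :: 'a::euclidean_space measure). P x"
  shows "AE z in (lebesgue :: ('a \<times> 'a) measure). P (fst z) \<and> P (snd z)"
proof -
  from assms have "AE x in (lborel :: 'a measure). P x" by (simp add: AE_completion_iff)
  then obtain N where N: "N \<in> null_sets lborel" "{x. \<not> P x} \<subseteq> N"
    by (auto elim!: AE_E simp: null_sets_def)
  have "N \<times> UNIV \<union> UNIV \<times> N \<in> null_sets (lborel :: ('a \<times> 'a) measure)"
    using lborel_null_sets_Times_UNIV[OF N(1), where 'b='a] by auto
  then have "AE z in (lborel :: ('a \<times> 'a) measure). P (fst z) \<and> P (snd z)"
    by (rule AE_I') (use N(2) in auto)
  then show ?thesis by (rule AE_completion)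
qed

text \<open>Lebesgue measure on the product is the completion of the product of the
  \<open>lborel\<close> measures. Both factors are replaced by Borel functions equal to them almost
  everywhere, and Tonelli's theorem is applied to those.\<close>

lemma nn_integral_lebesgue_fst_mult_snd:
  fixes f :: "'a::euclidean_space \<Rightarrow> ennreal" and g :: "'b::euclidean_space \<Rightarrow> ennreal"
  assumes "f \<in> borel_measurable lebesgue" and "g \<in> borel_measurable lebesgue"
  shows "(\<integral>\<^sup>+z. f (fst z) * g (snd z) \<partial>lebesgue) = (\<integral>\<^sup>+x. f x \<partial>lebesgue) * (\<integral>\<^sup>+y. g y \<partial>lebesgue)"
proof -
  obtain f' where f'[measurable]: "f' \<in> borel_measurable lborel" and ff: "AE x in lborel. f x = f' x"
    using completion_ex_borel_measurable[OF assms(1)] by auto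
  obtain g' where g'[measurable]: "g' \<in> borel_measurable lborel" and gg: "AE x in lborel. g x = g' x"
    using completion_ex_borel_measurable[OF assms(2)] by auto
  obtain N where N: "N \<in> null_sets lborel" "{x. f x \<noteq> f' x} \<subseteq> N"
    using ff by (auto elim!: AE_E simp: null_sets_def)
  obtain M where M: "M \<in> null_sets lborel" "{x. g x \<noteq> g' x} \<subseteq> M"
    using gg by (auto elim!: AE_E simp: null_sets_def)
  have "N \<times> UNIV \<union> UNIV \<times> M \<in> null_sets (lborel :: ('a \<times> 'b) measure)"
    using lborel_null_sets_Times_UNIV(1)[OF N(1), where 'b='b]
      lborel_null_sets_Times_UNIV(2)[OF M(1), where 'b='a] by auto
  then have "AE z in (lborel :: ('a \<times> 'b) measure). f (fst z) = f' (fst z) \<and> g (snd z) = g' (snd z)"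
    by (rule AE_I') (use N(2) M(2) in auto)
  then have ae: "AE z in (lborel :: ('a \<times> 'b) measure). f (fst z) * g (snd z) = f' (fst z) * g' (snd z)"
    by eventually_elim simp
  have "(\<integral>\<^sup>+z. f (fst z) * g (snd z) \<partial>lebesgue) = (\<integral>\<^sup>+z. f' (fst z) * g' (snd z) \<partial>(lborel \<Otimes>\<^sub>M lborel))"
    unfolding nn_integral_completion using nn_integral_cong_AE[OF ae] by (simp add: lborel_prod)
  also have "\<dots> = (\<integral>\<^sup>+x. \<integral>\<^sup>+y. f' x * g' y \<partial>lborel \<partial>lborel)"
    by (subst lborel.nn_integral_fst[symmetric]) auto
  also have "\<dots> = (\<integral>\<^sup>+x. f' x \<partial>lborel) * (\<integral>\<^sup>+y. g' y \<partial>lborel)"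
    by (simp add: nn_integral_cmult nn_integral_multc)
  also have "\<dots> = (\<integral>\<^sup>+x. f x \<partial>lebesgue) * (\<integral>\<^sup>+y. g y \<partial>lebesgue)"
    unfolding nn_integral_completion using nn_integral_cong_AE[OF ff] nn_integral_cong_AE[OF gg] by simp
  finally show ?thesis .
qed

section \<open>Inequalities for signed powers\<close>

lemma sgn_pow_minus: "sgn_pow p (- t) = - sgn_pow p t"
  by (simp add: sgn_pow_def)

lemma sgn_pow_nonneg_eq: "0 \<le> t \<Longrightarrow> sgn_pow p t = t powr (p - 1)"
  using powr_mult_base[of t "p - 2"] by (simp add: sgn_pow_def mult.commute algebra_simps)

lemma abs_sgn_pow: "\<bar>sgn_pow p t\<bar> = \<bar>t\<bar> powr (p - 1)"
proof (cases "0 \<le> t")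
  case True
  then show ?thesis by (simp add: sgn_pow_nonneg_eq)
next
  case False
  then have "- sgn_pow p t = (- t) powr (p - 1)"
    using sgn_pow_nonneg_eq[of "- t" p] by (simp add: sgn_pow_minus)
  then have "\<bar>sgn_pow p t\<bar> = \<bar>(- t) powr (p - 1)\<bar>" by linarith
  with False show ?thesis by simp
qed

lemma sgn_pow_strict_mono:
  assumes "1 < p" "a < b"
  shows "sgn_pow p a < sgn_pow p b"
proof -
  consider "0 \<le> a" | "a < 0" "0 \<le> b" | "b < 0" by linarith
  then show ?thesis
  proof cases
    case 1
    with assms show ?thesis by (simp add: sgn_pow_nonneg_eq powr_less_mono2)
  next
    case 2
    have "sgn_pow p a < 0" using \<open>a < 0\<close> by (simp add: sgn_pow_def mult_pos_neg)
    with 2 show ?thesis by (simp add: sgn_pow_nonneg_eq) (smt (verit) powr_ge_zero)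
  next
    case 3
    with assms have "sgn_pow p (- b) < sgn_pow p (- a)"
      by (simp add: sgn_pow_nonneg_eq powr_less_mono2 del: sgn_pow_minus)
    then show ?thesis by (simp add: sgn_pow_minus)
  qed
qed

lemma sgn_pow_mono: "1 < p \<Longrightarrow> a \<le> b \<Longrightarrow> sgn_pow p a \<le> sgn_pow p b"
  using sgn_pow_strict_mono[of p a b] by (cases "a = b") auto

text \<open>A crude form of Young's inequality: replacing the smaller of the two numbers by the
  larger one leaves a single \<open>p\<close>-th power. The constant is immaterial here.\<close>

lemma powr_mult_le_sum_powr:
  fixes a b p :: real
  assumes "1 < p" "0 \<le> a" "0 \<le> b"
  shows "a powr (p - 1) * b \<le> a powr p + b powr p"
proof -
  have pp: "x powr (p - 1) * x = x powr p" if "0 \<le> x" for x :: real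
    using that powr_mult_base[of x "p - 1"] by (simp add: mult.commute)
  show ?thesis
  proof (cases "a \<le> b")
    case True
    then have "a powr (p - 1) * b \<le> b powr (p - 1) * b"
      using assms by (intro mult_right_mono powr_mono2) auto
    then show ?thesis using pp[of b] assms by (simp add: add_increasing)
  next
    case False
    then have "a powr (p - 1) * b \<le> a powr (p - 1) * a"
      using assms by (intro mult_left_mono) auto
    then show ?thesis using pp[of a] assms by (simp add: add_increasing2)
  qed
qed

lemma powr_add_le:
  fixes a b p :: real
  assumes "0 \<le> p" "0 \<le> a" "0 \<le> b"
  shows "(a + b) powr p \<le> 2 powr p * (a powr p + b powr p)"
proof -
  have "(a + b) powr p \<le> (2 * max a b) powr p"
    using assms by (intro powr_mono2) auto
  also have "\<dots> = 2 powr p * max a b powr p" using assms by (simp add: powr_mult)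
  also have "max a b powr p \<le> a powr p + b powr p"
    by (auto simp: max_def)
  finally show ?thesis by simp
qed

lemma abs_diff_powr_le:
  fixes a b p :: real
  assumes "0 \<le> p"
  shows "\<bar>a - b\<bar> powr p \<le> 2 powr p * (\<bar>a\<bar> powr p + \<bar>b\<bar> powr p)"
proof -
  have "\<bar>a - b\<bar> powr p \<le> (\<bar>a\<bar> + \<bar>b\<bar>) powr p" using assms by (intro powr_mono2) auto
  also have "\<dots> \<le> 2 powr p * (\<bar>a\<bar> powr p + \<bar>b\<bar> powr p)" using assms by (intro powr_add_le) auto
  finally show ?thesis .
qed

text \<open>Write \<open>d = u1 - u2\<close>, \<open>D = v1 - v2\<close> and \<open>P > 0\<close>
  for the difference of the truncations. A negative product requires \<open>d < D\<close>.
  Positivity of \<open>P\<close> gives \<open>P \<le> a1 - a2 - D\<close>, hence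
  \<open>D \<le> \<alpha>\<close>. It also gives \<open>u1 > e\<close>, so that a nonpositive
  \<open>d\<close> is fully seen by the truncation at \<open>e\<close> and
  \<open>- d \<le> \<beta>\<close>. With \<open>m = max \<alpha> \<beta>\<close> the two signed
  powers differ by at most \<open>2 * m powr (p - 1)\<close>, and \<open>P \<le> 2 * m\<close>. Thus
  \<open>v1\<close> and \<open>v2\<close> drop out of the bound.\<close>

lemma sgn_pow_diff_mult_lower_bound_aux:
  fixes u1 u2 v1 v2 a1 a2 e p :: real
  assumes p: "1 < p" and e: "0 < e" and v: "0 \<le> v1" "0 \<le> v2"
    and a: "0 \<le> a1" "a1 \<le> max (u1 - e) 0" "0 \<le> a2" "a2 \<le> max (u2 - e) 0"
    and gt: "max (a1 - v1) 0 > max (a2 - v2) 0"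
  shows "(sgn_pow p (u1 - u2) - sgn_pow p (v1 - v2)) * (max (a1 - v1) 0 - max (a2 - v2) 0)
     \<ge> - 4 * (\<bar>max (u1 - e) 0 - max (u2 - e) 0\<bar> powr p + \<bar>a1 - a2\<bar> powr p)"
proof -
  define d where "d = u1 - u2"
  define D where "D = v1 - v2"
  define P where "P = max (a1 - v1) 0 - max (a2 - v2) 0"
  define \<alpha> where "\<alpha> = \<bar>a1 - a2\<bar>"
  define \<beta> where "\<beta> = \<bar>max (u1 - e) 0 - max (u2 - e) 0\<bar>"
  have P: "0 < P" "P \<le> (a1 - a2) - D" using gt by (auto simp: P_def D_def)
  have u1: "u1 > e" using gt a v by (auto simp: max_def split: if_splits)
  have "(sgn_pow p d - sgn_pow p D) * P \<ge> - (4 * (\<beta> powr p + \<alpha> powr p))"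
  proof (cases "D \<le> d")
    case True
    then have "0 \<le> (sgn_pow p d - sgn_pow p D) * P"
      using P sgn_pow_mono[OF p True] by simp
    moreover have "- (4 * (\<beta> powr p + \<alpha> powr p)) \<le> 0"
      using add_nonneg_nonneg[of "\<beta> powr p" "\<alpha> powr p"] by (simp only: neg_le_0_iff_le mult_nonneg_nonneg powr_ge_zero zero_le_numeral)
    ultimately show ?thesis by (rule order_trans[rotated])
  next
    case False
    have D: "D \<le> \<alpha>" using P by (simp add: \<alpha>_def)
    have d: "- d \<le> \<beta>" if "d \<le> 0"
      using that u1 by (auto simp: \<beta>_def d_def)
    define m where "m = max \<alpha> \<beta>"
    have m0: "0 \<le> m" by (simp add: m_def \<alpha>_def)
    have PM: "P \<le> 2 * m"
    proof -
      have "P \<le> \<alpha> + \<beta>"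
      proof (cases "0 \<le> D")
        case True
        then have "P \<le> \<alpha>" using P by (simp add: \<alpha>_def)
        then show ?thesis by (simp add: \<beta>_def)
      next
        case neg: False
        \<comment> \<open>Here \<open>d < D < 0\<close>, so the bound on \<open>- d\<close> also
          controls \<open>- D\<close>.\<close>
        then have "- D \<le> \<beta>" using d False by linarith
        moreover have "a1 - a2 \<le> \<alpha>" by (simp add: \<alpha>_def)
        ultimately show ?thesis using P by linarith
      qed
      then show ?thesis by (auto simp: m_def)
    qed
    have "sgn_pow p D \<le> sgn_pow p m" using D by (intro sgn_pow_mono[OF p]) (simp add: m_def)
    moreover have "sgn_pow p (- m) \<le> sgn_pow p d"
      using d m0 by (intro sgn_pow_mono[OF p]) (cases "d \<le> 0"; force simp: m_def)
    ultimately have "sgn_pow p D - sgn_pow p d \<le> 2 * m powr (p - 1)"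
      using m0 by (simp add: sgn_pow_minus sgn_pow_nonneg_eq)
    then have "(sgn_pow p D - sgn_pow p d) * P \<le> (2 * m powr (p - 1)) * P"
      using P by (intro mult_right_mono) auto
    also have "\<dots> \<le> (2 * m powr (p - 1)) * (2 * m)"
      using PM by (intro mult_left_mono) auto
    also have "\<dots> = 4 * m powr p"
      using powr_mult_base[OF m0, of "p - 1"] by (simp add: mult.commute)
    also have "m powr p \<le> \<beta> powr p + \<alpha> powr p" by (auto simp: m_def max_def)
    finally show ?thesis by (simp add: algebra_simps)
  qed
  then show ?thesis by (simp add: d_def D_def P_def \<alpha>_def \<beta>_def)
qed

lemma sgn_pow_diff_mult_lower_bound:
  fixes u1 u2 v1 v2 a1 a2 e p :: real
  assumes p: "1 < p" and e: "0 < e" and v: "0 \<le> v1" "0 \<le> v2"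
    and a: "0 \<le> a1" "a1 \<le> max (u1 - e) 0" "0 \<le> a2" "a2 \<le> max (u2 - e) 0"
  shows "(sgn_pow p (u1 - u2) - sgn_pow p (v1 - v2)) * (max (a1 - v1) 0 - max (a2 - v2) 0)
     \<ge> - 4 * (\<bar>max (u1 - e) 0 - max (u2 - e) 0\<bar> powr p + \<bar>a1 - a2\<bar> powr p)"
proof -
  consider "max (a1 - v1) 0 > max (a2 - v2) 0" | "max (a2 - v2) 0 > max (a1 - v1) 0"
    | "max (a1 - v1) 0 = max (a2 - v2) 0" by linarith
  then show ?thesis
  proof cases
    case 1
    then show ?thesis by (intro sgn_pow_diff_mult_lower_bound_aux assms)
  next
    case 2
    \<comment> \<open>Exchanging the two points flips the sign of both factors, since
      \<open>sgn_pow\<close> is odd, and leaves the product unchanged.\<close>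
    from sgn_pow_diff_mult_lower_bound_aux[OF p e v(2,1) a(3,4,1,2) this]
    show ?thesis
      using sgn_pow_minus[of p "u1 - u2"] sgn_pow_minus[of p "v1 - v2"]
      by (simp add: abs_minus_commute algebra_simps)
  next
    case 3
    moreover have "- 4 * (\<bar>max (u1 - e) 0 - max (u2 - e) 0\<bar> powr p + \<bar>a1 - a2\<bar> powr p) \<le> 0"
      by (intro mult_nonpos_nonneg add_nonneg_nonneg powr_ge_zero) simp
    ultimately show ?thesis by simp
  qed
qed

text \<open>A strict order between the truncations of \<open>u1 - v1 - c\<close> and
  \<open>u2 - v2 - c\<close> forces the same strict order between \<open>u1 - u2\<close> and
  \<open>v1 - v2\<close>. Strict monotonicity of \<open>sgn_pow\<close> then makes the signs of the
  two factors agree.\<close>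

lemma sgn_pow_diff_mult_pos:
  fixes u1 u2 v1 v2 c p :: real
  assumes "1 < p"
  shows "0 \<le> (sgn_pow p (u1 - u2) - sgn_pow p (v1 - v2)) * (max (u1 - v1 - c) 0 - max (u2 - v2 - c) 0)"
    and "max (u1 - v1 - c) 0 \<noteq> max (u2 - v2 - c) 0 \<Longrightarrow>
      0 < (sgn_pow p (u1 - u2) - sgn_pow p (v1 - v2)) * (max (u1 - v1 - c) 0 - max (u2 - v2 - c) 0)"
proof -
  let ?P = "max (u1 - v1 - c) 0 - max (u2 - v2 - c) 0"
  have *: "0 < (sgn_pow p (u1 - u2) - sgn_pow p (v1 - v2)) * ?P" if "?P \<noteq> 0"
  proof (cases "?P > 0")
    case True
    then have "v1 - v2 < u1 - u2" by (auto simp: max_def split: if_splits)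
    then show ?thesis using sgn_pow_strict_mono[OF assms] True by simp
  next
    case False
    with that have "?P < 0" "u1 - u2 < v1 - v2" by (auto simp: max_def split: if_splits)
    then show ?thesis using sgn_pow_strict_mono[OF assms] by (simp add: mult_neg_neg)
  qed
  show "max (u1 - v1 - c) 0 \<noteq> max (u2 - v2 - c) 0 \<Longrightarrow>
      0 < (sgn_pow p (u1 - u2) - sgn_pow p (v1 - v2)) * ?P" using * by simp
  show "0 \<le> (sgn_pow p (u1 - u2) - sgn_pow p (v1 - v2)) * ?P"
    using * by (cases "?P = 0") auto
qed

text \<open>Above the level \<open>e\<close> the function \<open>t powr \<kappa>\<close> has slope
  at least \<open>e powr (\<kappa> - 1)\<close>, so truncation at \<open>e\<close> is a Lipschitz
  function of the \<open>\<kappa>\<close>-th power. In this way \<open>(u - e)\<close> truncated at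
  0 inherits finite energy from \<open>u powr \<kappa>\<close>.\<close>

lemma abs_diff_max_le_powr:
  fixes a b e \<kappa> :: real
  assumes e: "0 < e" and \<kappa>: "1 \<le> \<kappa>" and ab: "0 \<le> a" "0 \<le> b"
  shows "\<bar>max (a - e) 0 - max (b - e) 0\<bar> \<le> e powr (1 - \<kappa>) * \<bar>a powr \<kappa> - b powr \<kappa>\<bar>"
proof -
  have main: "max (a - e) 0 - max (b - e) 0 \<le> e powr (1 - \<kappa>) * (a powr \<kappa> - b powr \<kappa>)"
    if "0 \<le> b" "b \<le> a" for a b
  proof (cases "a \<le> e")
    case True
    then show ?thesis using that \<kappa> by (simp add: powr_mono2)
  next
    case False
    \<comment> \<open>Truncation does not distinguish \<open>b\<close> from \<open>c\<close>,
      whereas the slope estimate is valid only above \<open>e\<close>.\<close>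
    define c where "c = max b e"
    have c: "e \<le> c" "c \<le> a" "b \<le> c" using False that by (auto simp: c_def)
    have ge: "x powr \<kappa> = x powr (\<kappa> - 1) * x" if "0 < x" for x
      using powr_mult_base[of x "\<kappa> - 1"] that by (simp add: mult.commute)
    have "e powr (\<kappa> - 1) * (a - c) \<le> c powr (\<kappa> - 1) * (a - c)"
      using c e \<kappa> by (intro mult_right_mono powr_mono2) auto
    also have "\<dots> \<le> a powr (\<kappa> - 1) * a - c powr (\<kappa> - 1) * c"
    proof -
      have "c powr (\<kappa> - 1) * a \<le> a powr (\<kappa> - 1) * a"
        using c e \<kappa> by (intro mult_right_mono powr_mono2) auto
      then show ?thesis by (simp add: algebra_simps)
    qed
    also have "\<dots> = a powr \<kappa> - c powr \<kappa>" using ge[of a] ge[of c] c e by simp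
    also have "\<dots> \<le> a powr \<kappa> - b powr \<kappa>" using c that \<kappa> by (simp add: powr_mono2)
    finally have "e powr (1 - \<kappa>) * (e powr (\<kappa> - 1) * (a - c)) \<le> e powr (1 - \<kappa>) * (a powr \<kappa> - b powr \<kappa>)"
      by (intro mult_left_mono) auto
    moreover have "e powr (1 - \<kappa>) * e powr (\<kappa> - 1) = 1"
      using e by (simp flip: powr_add)
    moreover have "max (a - e) 0 - max (b - e) 0 = a - c" using False by (auto simp: c_def)
    ultimately show ?thesis by (simp add: mult.assoc[symmetric])
  qed
  show ?thesis
  proof (cases "b \<le> a")
    case True
    then have "b powr \<kappa> \<le> a powr \<kappa>" using ab \<kappa> by (intro powr_mono2) auto
    with main[of b a] True ab show ?thesis by (auto simp: max_def)
  next
    case False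
    then have "a powr \<kappa> \<le> b powr \<kappa>" using ab \<kappa> by (intro powr_mono2) auto
    with main[of a b] False ab show ?thesis by (auto simp: max_def)
  qed
qed

section \<open>Translations and the boundary\<close>

text \<open>Continuity of translation in the \<open>L1\<close> sense. The function is approximated
  by a continuous one on a ball; for the latter the claim is dominated convergence, and translation
  invariance makes the two approximation errors equal.\<close>

lemma nn_integral_translate_diff_tendsto_0:
  fixes f :: "'a::euclidean_space \<Rightarrow> real" and h :: "nat \<Rightarrow> 'a"
  assumes [measurable]: "f \<in> borel_measurable lebesgue"
    and bd: "\<And>x. \<bar>f x\<bar> \<le> B" and supp: "\<And>x. x \<notin> cball 0 R \<Longrightarrow> f x = 0" and h: "h \<longlonglongrightarrow> 0"
  shows "(\<lambda>n. \<integral>\<^sup>+x. ennreal \<bar>f (x - h n) - f x\<bar> \<partial>lebesgue) \<longlonglongrightarrow> 0"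
proof -
  have [measurable]: "cball 0 r \<in> sets (lebesgue :: 'a measure)" for r by simp
  have B: "0 \<le> B" using bd[of 0] by simp
  have "f measurable_on UNIV"
    using measurable_on_iff_borel_measurable[of UNIV f] by (simp add: lebesgue_on_UNIV_eq)
  then obtain N g where N: "negligible N" and cont: "\<And>n. continuous_on UNIV (g n)"
    and lim: "\<And>x. x \<notin> N \<Longrightarrow> (\<lambda>n. g n x) \<longlonglongrightarrow> f x"
    unfolding measurable_on_def by auto
  \<comment> \<open>Clipping at \<open>B\<close> keeps the limit \<open>f\<close>, which is bounded
    by \<open>B\<close>, and supplies a constant majorant for dominated convergence.\<close>
  define G where "G n x = max (- B) (min B (g n x))" for n x
  have contG: "continuous_on UNIV (G n)" for n
    unfolding G_def by (intro continuous_intros cont)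
  have mG [measurable]: "G n \<in> borel_measurable lebesgue" for n
    using contG[of n] by (simp add: borel_measurable_continuous_onI measurable_completion)
  have bG: "\<bar>G n x\<bar> \<le> B" for n x using B by (auto simp: G_def)
  have limG: "(\<lambda>n. G n x) \<longlonglongrightarrow> f x" if "x \<notin> N" for x
  proof -
    have "(\<lambda>n. G n x) \<longlonglongrightarrow> max (- B) (min B (f x))"
      unfolding G_def by (intro tendsto_intros lim that)
    moreover have "max (- B) (min B (f x)) = f x" using bd[of x] by auto
    ultimately show ?thesis by simp
  qed
  have AEN: "AE x in lebesgue. x \<notin> N"
    using N by (simp add: negligible_iff_null_sets AE_not_in)
  \<comment> \<open>The approximants may be nonzero far away, so all comparisons are cut off. For
    shifts shorter than 1, the difference of \<open>f\<close> and its translate vanishes outside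
    radius \<open>R + 1\<close>, and a point within that radius is moved to one within
    \<open>R + 2\<close>.\<close>
  define A where "A k = (\<integral>\<^sup>+x. ennreal \<bar>f x - G k x\<bar> * indicator (cball 0 (R + 2)) x \<partial>lebesgue)" for k
  have fin: "(\<integral>\<^sup>+x. ennreal (2 * B) * indicator (cball 0 r) (x::'a) \<partial>lebesgue) < \<infinity>" for r
    using emeasure_lborel_cball_finite[of "0::'a" r] by (simp add: nn_integral_cmult_indicator ennreal_mult_less_top)
  have A: "A \<longlonglongrightarrow> 0"
  proof -
    have "A \<longlonglongrightarrow> (\<integral>\<^sup>+(x::'a). 0 \<partial>lebesgue)" unfolding A_def
    proof (rule nn_integral_dominated_convergence)
      show "(\<integral>\<^sup>+x. ennreal (2 * B) * indicator (cball 0 (R + 2)) (x::'a) \<partial>lebesgue) < \<infinity>" by (rule fin)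
      show "AE x in lebesgue. ennreal \<bar>f x - G j x\<bar> * indicator (cball 0 (R + 2)) x
              \<le> ennreal (2 * B) * indicator (cball 0 (R + 2)) x" for j
      proof (intro AE_I2 mult_right_mono ennreal_leI)
        show "\<bar>f x - G j x\<bar> \<le> 2 * B" for x using bd[of x] bG[of j x] by linarith
      qed simp
      show "AE x in lebesgue. (\<lambda>k. ennreal \<bar>f x - G k x\<bar> * indicator (cball 0 (R + 2)) x) \<longlonglongrightarrow> 0"
        using AEN
      proof eventually_elim
        case (elim x)
        have "(\<lambda>k. ennreal \<bar>f x - G k x\<bar>) \<longlonglongrightarrow> ennreal \<bar>f x - f x\<bar>"
          by (intro tendsto_intros tendsto_ennrealI limG elim)
        then show ?case by (auto simp: indicator_def)
      qed
    qed measurable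
    then show ?thesis by simp
  qed
  show ?thesis
  proof (rule tendsto_zero_ennreal)
    fix \<eta> :: real assume \<eta>: "0 < \<eta>"
    have "\<forall>\<^sub>F k in sequentially. A k < ennreal (\<eta> / 3)"
      using order_tendstoD(2)[OF A, of "ennreal (\<eta> / 3)"] \<eta> by simp
    then obtain k where k: "A k < ennreal (\<eta> / 3)" by (auto simp: eventually_sequentially)
    define D where "D n = (\<integral>\<^sup>+x. ennreal \<bar>G k (x - h n) - G k x\<bar> * indicator (cball 0 (R + 1)) x \<partial>lebesgue)" for n
    have D: "D \<longlonglongrightarrow> 0"
    proof -
      have "D \<longlonglongrightarrow> (\<integral>\<^sup>+(x::'a). 0 \<partial>lebesgue)" unfolding D_def
      proof (rule nn_integral_dominated_convergence)
        show "(\<integral>\<^sup>+x. ennreal (2 * B) * indicator (cball 0 (R + 1)) (x::'a) \<partial>lebesgue) < \<infinity>" by (rule fin)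
        show "AE x in lebesgue. ennreal \<bar>G k (x - h j) - G k x\<bar> * indicator (cball 0 (R + 1)) x
                \<le> ennreal (2 * B) * indicator (cball 0 (R + 1)) x" for j
        proof (intro AE_I2 mult_right_mono ennreal_leI)
          show "\<bar>G k (x - h j) - G k x\<bar> \<le> 2 * B" for x using bG[of k x] bG[of k "x - h j"] by linarith
        qed simp
        show "AE x in lebesgue. (\<lambda>n. ennreal \<bar>G k (x - h n) - G k x\<bar> * indicator (cball 0 (R + 1)) x) \<longlonglongrightarrow> 0"
        proof (rule AE_I2)
          fix x
          have "(\<lambda>n. x - h n) \<longlonglongrightarrow> x - 0" by (intro tendsto_intros h)
          then have "(\<lambda>n. G k (x - h n)) \<longlonglongrightarrow> G k x"
            using contG[of k] by (auto intro: continuous_on_tendsto_compose)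
          then have "(\<lambda>n. ennreal \<bar>G k (x - h n) - G k x\<bar>) \<longlonglongrightarrow> ennreal \<bar>G k x - G k x\<bar>"
            by (intro tendsto_intros tendsto_ennrealI)
          then show "(\<lambda>n. ennreal \<bar>G k (x - h n) - G k x\<bar> * indicator (cball 0 (R + 1)) x) \<longlonglongrightarrow> 0"
            by (auto simp: indicator_def)
        qed
      qed measurable
      then show ?thesis by simp
    qed
    have evD: "\<forall>\<^sub>F n in sequentially. D n < ennreal (\<eta> / 3)"
      using order_tendstoD(2)[OF D, of "ennreal (\<eta> / 3)"] \<eta> by simp
    have evh: "\<forall>\<^sub>F n in sequentially. norm (h n) < 1"
      using tendstoD[OF h, of 1] by (simp add: dist_norm)
    show "\<forall>\<^sub>F n in sequentially. (\<integral>\<^sup>+x. ennreal \<bar>f (x - h n) - f x\<bar> \<partial>lebesgue) < ennreal \<eta>"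
      using evD evh
    proof eventually_elim
      case (elim n)
      let ?a = "\<lambda>x. ennreal \<bar>f x - G k x\<bar> * indicator (cball 0 (R + 2)) x"
      let ?d = "\<lambda>x. ennreal \<bar>G k (x - h n) - G k x\<bar> * indicator (cball 0 (R + 1)) x"
      have pt: "ennreal \<bar>f (x - h n) - f x\<bar> \<le> ?a (x - h n) + ?d x + ?a x" for x
      proof (cases "x \<in> cball 0 (R + 1)")
        case True
        have "norm (x - h n) \<le> norm x + norm (h n)" by (rule norm_triangle_ineq4)
        with True elim have "x - h n \<in> cball 0 (R + 2)" "x \<in> cball 0 (R + 2)" by auto
        moreover have "\<bar>f (x - h n) - f x\<bar> \<le> \<bar>f (x - h n) - G k (x - h n)\<bar> + \<bar>G k (x - h n) - G k x\<bar> + \<bar>f x - G k x\<bar>"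
          by linarith
        ultimately show ?thesis using True by (simp flip: ennreal_plus)
      next
        case False
        have "norm x \<le> norm (x - h n) + norm (h n)" using norm_triangle_ineq2[of x "h n"] by simp
        with False elim have "x - h n \<notin> cball 0 R" "x \<notin> cball 0 R" by auto
        then show ?thesis by (simp add: supp)
      qed
      have m3: "?a \<in> borel_measurable lebesgue" by measurable
      have m: "(\<lambda>x. ?a (x - h n)) \<in> borel_measurable lebesgue" "?d \<in> borel_measurable lebesgue"
        "?a \<in> borel_measurable lebesgue"
        using translate_lebesgue_measurable[OF m3, of "h n"] m3 by measurable
      then have m12: "(\<lambda>x. ?a (x - h n) + ?d x) \<in> borel_measurable lebesgue" by measurable
      have "(\<integral>\<^sup>+x. ennreal \<bar>f (x - h n) - f x\<bar> \<partial>lebesgue) \<le> (\<integral>\<^sup>+x. ?a (x - h n) + ?d x + ?a x \<partial>lebesgue)"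
        by (intro nn_integral_mono pt)
      also have "\<dots> = (\<integral>\<^sup>+x. ?a (x - h n) \<partial>lebesgue) + D n + A k"
        unfolding D_def A_def nn_integral_add[OF m12 m(3)] nn_integral_add[OF m(1,2)] ..
      also have "(\<integral>\<^sup>+x. ?a (x - h n) \<partial>lebesgue) = A k"
        unfolding A_def by (rule nn_integral_lebesgue_translate[OF m3])
      also have "A k + D n + A k < ennreal (\<eta> / 3) + ennreal (\<eta> / 3) + ennreal (\<eta> / 3)"
        using k elim by (intro add_strict_mono)
      also have "\<dots> = ennreal \<eta>" using \<eta> by (simp flip: ennreal_plus)
      finally show ?case .
    qed
  qed
qed

text \<open>No integrability of \<open>f\<close> is available, so the \<open>L1\<close> result is
  applied to \<open>arctan\<close> of \<open>f\<close>, which is bounded and vanishes where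
  \<open>f\<close> does; \<open>tan\<close> undoes the substitution. Summing over \<open>E\<close>
  first yields one subsequence for all directions.\<close>

lemma AE_translate_subseq:
  fixes f :: "'a::euclidean_space \<Rightarrow> real" and t :: "nat \<Rightarrow> real"
  assumes [measurable]: "f \<in> borel_measurable lebesgue"
    and supp: "\<And>x. x \<notin> S \<Longrightarrow> f x = 0" and S: "bounded S" and t: "t \<longlonglongrightarrow> 0" and E: "finite E"
  shows "\<exists>r. strict_mono r \<and> (AE x in lebesgue. \<forall>e\<in>E. (\<lambda>n. f (x - t (r n) *\<^sub>R e)) \<longlonglongrightarrow> f x)"
proof -
  obtain R where R: "S \<subseteq> cball 0 R" using S bounded_subset_ballD[OF S, of 0] ball_subset_cball by blast
  define g where "g x = arctan (f x)" for x
  have [measurable]: "g \<in> borel_measurable lebesgue"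
    unfolding g_def by (rule measurable_compose[OF assms(1)])
      (intro borel_measurable_continuous_onI continuous_intros)
  define F where "F n x = (\<Sum>e\<in>E. \<bar>g (x - t n *\<^sub>R e) - g x\<bar>)" for n x
  have [measurable]: "F n \<in> borel_measurable lebesgue" for n
    unfolding F_def by measurable
  have F0: "0 \<le> F n x" for n x by (simp add: F_def sum_nonneg)
  have lim: "(\<lambda>n. \<integral>\<^sup>+x. ennreal (F n x) \<partial>lebesgue) \<longlonglongrightarrow> 0"
  proof -
    have "(\<lambda>n. \<integral>\<^sup>+x. ennreal \<bar>g (x - t n *\<^sub>R e) - g x\<bar> \<partial>lebesgue) \<longlonglongrightarrow> 0" for e
    proof (rule nn_integral_translate_diff_tendsto_0[where B = "pi/2" and R = R])
      show "\<bar>g x\<bar> \<le> pi / 2" for x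
        unfolding g_def using arctan_bounded[of "f x"] by (intro abs_leI) linarith+
      show "g x = 0" if "x \<notin> cball 0 R" for x
      proof -
        from that R have "x \<notin> S" by blast
        then show ?thesis by (simp add: g_def supp)
      qed
      show "(\<lambda>n. t n *\<^sub>R e) \<longlonglongrightarrow> 0"
        using tendsto_scaleR[OF t tendsto_const[of e]] by simp
    qed measurable
    then have "(\<lambda>n. \<Sum>e\<in>E. \<integral>\<^sup>+x. ennreal \<bar>g (x - t n *\<^sub>R e) - g x\<bar> \<partial>lebesgue) \<longlonglongrightarrow> (\<Sum>e\<in>E. 0)"
      by (intro tendsto_sum)
    moreover have "(\<Sum>e\<in>E. \<integral>\<^sup>+x. ennreal \<bar>g (x - t n *\<^sub>R e) - g x\<bar> \<partial>lebesgue) = (\<integral>\<^sup>+x. ennreal (F n x) \<partial>lebesgue)" for n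
      by (subst nn_integral_sum[symmetric]) (auto simp: F_def sum_ennreal)
    ultimately show ?thesis by simp
  qed
  \<comment> \<open>From \<open>n0\<close> on the integrals are finite, so these terms are
    integrable, as the subsequence theorem demands; the shift is absorbed into the final
    subsequence.\<close>
  obtain n0 where n0: "\<And>n. n \<ge> n0 \<Longrightarrow> (\<integral>\<^sup>+x. ennreal (F n x) \<partial>lebesgue) < 1"
    using order_tendstoD(2)[OF lim, of 1] by (auto simp: eventually_sequentially)
  have int: "integrable lebesgue (F (n + n0))" for n
  proof (rule integrableI_bounded)
    show "(\<integral>\<^sup>+x. ennreal (norm (F (n + n0) x)) \<partial>lebesgue) < \<infinity>"
      using n0[of "n + n0"] F0 by (simp add: order_less_trans[OF _ ennreal_one_less_top])
  qed measurable
  have "(\<lambda>n. ennreal (\<integral>x. norm (F (n + n0) x) \<partial>lebesgue)) \<longlonglongrightarrow> 0"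
  proof -
    have "ennreal (\<integral>x. norm (F (n + n0) x) \<partial>lebesgue) = (\<integral>\<^sup>+x. ennreal (F (n + n0) x) \<partial>lebesgue)" for n
      using nn_integral_eq_integral[OF int[of n]] F0 by simp
    then show ?thesis using LIMSEQ_ignore_initial_segment[OF lim, of n0] by simp
  qed
  then have "(\<lambda>n. \<integral>x. norm (F (n + n0) x) \<partial>lebesgue) \<longlonglongrightarrow> 0"
    by (subst (asm) ennreal_tendsto_0_iff) auto
  from tendsto_L1_AE_subseq[OF int this] obtain r :: "nat \<Rightarrow> nat"
    where r: "strict_mono r" and ae: "AE x in lebesgue. (\<lambda>n. F (r n + n0) x) \<longlonglongrightarrow> 0" by blast
  have "AE x in lebesgue. \<forall>e\<in>E. (\<lambda>n. f (x - t (r n + n0) *\<^sub>R e)) \<longlonglongrightarrow> f x"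
    using ae
  proof eventually_elim
    case (elim x)
    show ?case
    proof
      fix e assume e: "e \<in> E"
      have "(\<lambda>n. g (x - t (r n + n0) *\<^sub>R e) - g x) \<longlonglongrightarrow> 0"
      proof (rule Lim_null_comparison[OF always_eventually elim], rule allI)
        show "norm (g (x - t (r n + n0) *\<^sub>R e) - g x) \<le> F (r n + n0) x" for n
          unfolding F_def real_norm_def
          by (rule member_le_sum[OF e]) (auto simp: E)
      qed
      then have "(\<lambda>n. g (x - t (r n + n0) *\<^sub>R e)) \<longlonglongrightarrow> g x" by (simp add: LIM_zero_iff)
      then have "(\<lambda>n. tan (g (x - t (r n + n0) *\<^sub>R e))) \<longlonglongrightarrow> tan (g x)"
        by (rule isCont_tendsto_compose[OF isCont_tan, rotated]) (simp add: g_def)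
      then show "(\<lambda>n. f (x - t (r n + n0) *\<^sub>R e)) \<longlonglongrightarrow> f x"
        by (simp add: g_def tan_arctan)
    qed
  qed
  moreover have "strict_mono (\<lambda>n. r n + n0)" using r by (simp add: strict_mono_def)
  ultimately show ?thesis by blast
qed

text \<open>In a chart a boundary point lies on or below the graph, and moving it by
  \<open>- t *\<^sub>R e\<close> lowers its height without changing its projection. It lands in the
  open region strictly below the graph, outside \<Omega>. Compactness of the boundary leaves
  finitely many charts.\<close>

lemma frontier_directions:
  fixes \<Omega> :: "'a::euclidean_space set"
  assumes "open \<Omega>" "bounded \<Omega>" "C11_boundary \<Omega>"
  obtains E :: "'a set" and \<rho> :: real where "finite E" "0 \<in> E" "0 < \<rho>"
    "\<forall>t z. 0 < t \<and> t < \<rho> \<and> z \<in> frontier \<Omega> \<longrightarrow> (\<exists>e\<in>E. z - t *\<^sub>R e \<in> interior (- \<Omega>))"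
proof -
  have chart: "\<exists>r e. 0 < r \<and> (\<forall>t z. 0 < t \<longrightarrow> t < r \<longrightarrow> z \<in> frontier \<Omega> \<inter> ball x0 r \<longrightarrow> z - t *\<^sub>R e \<in> interior (- \<Omega>))"
    if x0: "x0 \<in> frontier \<Omega>" for x0
  proof -
    obtain r e f g where r: "0 < r" and e: "norm e = 1"
      and f: "\<And>y. (f has_derivative (\<lambda>h. (g y :: 'a) \<bullet> h)) (at y)"
      and eq: "\<Omega> \<inter> ball x0 r = {y \<in> ball x0 r. f (y - (y \<bullet> e) *\<^sub>R e) < y \<bullet> e}"
      using assms(3)[unfolded C11_boundary_def, rule_format, OF x0] by blast
    have ee: "e \<bullet> e = 1" using e by (simp add: norm_eq_1)
    have cf: "continuous_on UNIV f" using f by (intro continuous_at_imp_continuous_on ballI has_derivative_continuous)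
    define W where "W = ball x0 r \<inter> {y. y \<bullet> e < f (y - (y \<bullet> e) *\<^sub>R e)}"
    have "open W" unfolding W_def
      by (intro open_Int open_ball open_Collect_less continuous_intros continuous_on_compose2[OF cf]) auto
    moreover have "W \<subseteq> - \<Omega>"
    proof
      fix x assume "x \<in> W"
      then show "x \<in> - \<Omega>" using eqset_imp_iff[OF eq, of x] by (auto simp: W_def)
    qed
    ultimately have W: "W \<subseteq> interior (- \<Omega>)" by (rule interior_maximal[rotated])
    \<comment> \<open>Halving the radius keeps the shifted point inside the chart ball.\<close>
    have "z - t *\<^sub>R e \<in> W" if t: "0 < t" "t < r / 2" and z: "z \<in> frontier \<Omega> \<inter> ball x0 (r / 2)" for t z
    proof -
      have "z \<notin> \<Omega>" using z assms(1) by (auto simp: frontier_def interior_open)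
      moreover have "z \<in> ball x0 r" using z r by auto
      ultimately have "z \<bullet> e \<le> f (z - (z \<bullet> e) *\<^sub>R e)" using eq by force
      moreover have "(z - t *\<^sub>R e) \<bullet> e = z \<bullet> e - t" by (simp add: inner_diff_left ee)
      moreover have "z - t *\<^sub>R e - (z \<bullet> e - t) *\<^sub>R e = z - (z \<bullet> e) *\<^sub>R e" by (simp add: algebra_simps)
      moreover have "z - t *\<^sub>R e \<in> ball x0 r"
      proof -
        have "dist x0 (z - t *\<^sub>R e) \<le> dist x0 z + dist z (z - t *\<^sub>R e)" by (rule dist_triangle)
        also have "dist z (z - t *\<^sub>R e) = t" using e t by (simp add: dist_norm)
        finally show ?thesis using t z by simp
      qed
      ultimately show ?thesis using t unfolding W_def by (simp only: Int_iff mem_Collect_eq) simp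
    qed
    with W r show ?thesis by (intro exI[of _ "r / 2"] exI[of _ e]) auto
  qed
  then obtain r e where r: "\<And>x. x \<in> frontier \<Omega> \<Longrightarrow> 0 < r x"
    and e: "\<And>x t z. x \<in> frontier \<Omega> \<Longrightarrow> 0 < t \<Longrightarrow> t < r x \<Longrightarrow> z \<in> frontier \<Omega> \<inter> ball x (r x) \<Longrightarrow> z - t *\<^sub>R e x \<in> interior (- \<Omega>)"
    by metis
  have "compact (frontier \<Omega>)" using assms(2) by (rule compact_frontier_bounded)
  moreover have "frontier \<Omega> \<subseteq> (\<Union>x\<in>frontier \<Omega>. ball x (r x))" using r by auto
  ultimately obtain F where F: "F \<subseteq> frontier \<Omega>" "finite F" "frontier \<Omega> \<subseteq> (\<Union>x\<in>F. ball x (r x))"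
    by (rule compactE_image[OF _ open_ball])
  show ?thesis
  \<comment> \<open>The direction 0 makes the later minimum of translates lie below the untranslated
    function; the entry 1 keeps \<open>Min\<close> meaningful should \<open>F\<close> be
    empty.\<close>
  proof (rule that[of "insert 0 (e ` F)" "Min (insert 1 (r ` F))"])
    show "0 < Min (insert 1 (r ` F))" using F r by auto
    show "\<forall>t z. 0 < t \<and> t < Min (insert 1 (r ` F)) \<and> z \<in> frontier \<Omega> \<longrightarrow>
      (\<exists>e'\<in>insert 0 (e ` F). z - t *\<^sub>R e' \<in> interior (- \<Omega>))"
    proof (intro allI impI; elim conjE)
      fix t z assume t: "0 < t" "t < Min (insert 1 (r ` F))" and z: "z \<in> frontier \<Omega>"
      then obtain x where x: "x \<in> F" "z \<in> ball x (r x)" using F by auto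
      then have "t < r x" using t F by auto
      then have "z - t *\<^sub>R e x \<in> interior (- \<Omega>)" using e[of x t z] x F z t by auto
      then show "\<exists>e'\<in>insert 0 (e ` F). z - t *\<^sub>R e' \<in> interior (- \<Omega>)" using x by auto
    qed
  qed (use F in auto)
qed

text \<open>The minimum vanishes on the open set \<open>U\<close> of points that some direction
  moves into the interior of the complement, and outside \<Omega> because \<open>0 \<in> E\<close>.
  Since \<open>U\<close> covers the boundary, what remains of the closure is a compact subset of
  \<Omega>.\<close>

lemma Min_translates_compact_support:
  fixes \<Omega> :: "'a::euclidean_space set" and \<psi> :: "'a \<Rightarrow> real"
  assumes "bounded \<Omega>" "finite E" "0 \<in> E"
    and out: "\<And>z. z \<in> frontier \<Omega> \<Longrightarrow> \<exists>e\<in>E. z - t *\<^sub>R e \<in> interior (- \<Omega>)"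
    and \<psi>: "\<And>x. 0 \<le> \<psi> x" "\<And>x. x \<notin> \<Omega> \<Longrightarrow> \<psi> x = 0"
  shows "\<exists>C. compact C \<and> C \<subseteq> \<Omega> \<and> (\<forall>x. x \<notin> C \<longrightarrow> Min ((\<lambda>e. \<psi> (x - t *\<^sub>R e)) ` E) = 0)"
proof -
  define U where "U = (\<Union>e\<in>E. (\<lambda>x. x - t *\<^sub>R e) -` interior (- \<Omega>))"
  have "open U" unfolding U_def
    by (intro open_UN ballI open_vimage open_interior continuous_intros)
  then have "compact (closure \<Omega> - U)" using assms(1) by (simp add: compact_diff)
  moreover have "closure \<Omega> - U \<subseteq> \<Omega>"
    using out interior_subset[of \<Omega>] by (fastforce simp: U_def frontier_def)
  moreover have "Min ((\<lambda>e. \<psi> (x - t *\<^sub>R e)) ` E) = 0" if x: "x \<notin> closure \<Omega> - U" for x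
  proof -
    have "\<exists>e\<in>E. \<psi> (x - t *\<^sub>R e) = 0"
    proof (cases "x \<in> U")
      case True
      then show ?thesis using \<psi>(2) interior_subset[of "- \<Omega>"] by (auto simp: U_def)
    next
      case False
      with x have "x \<notin> \<Omega>" using closure_subset by auto
      then show ?thesis using assms(3) \<psi>(2) by (intro bexI[of _ 0]) auto
    qed
    then obtain e where "e \<in> E" "\<psi> (x - t *\<^sub>R e) = 0" by auto
    then show ?thesis
      using assms(2) \<psi>(1) by (intro Min_eqI) (auto intro!: image_eqI[of _ _ e])
  qed
  ultimately show ?thesis by blast
qed

text \<open>The minimum is 1-Lipschitz for the maximum norm, and the largest of finitely many
  nonnegative terms is at most their sum. This bounds the energy of a minimum of translates by the
  energies of the translates.\<close>

lemma abs_Min_image_diff_powr_le: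
  fixes f g :: "'a \<Rightarrow> real"
  assumes "finite E" "E \<noteq> {}" "0 \<le> p"
  shows "\<bar>Min (f ` E) - Min (g ` E)\<bar> powr p \<le> (\<Sum>e\<in>E. \<bar>f e - g e\<bar> powr p)"
proof -
  have main: "\<exists>e\<in>E. Min (f ` E) - Min (g ` E) \<le> f e - g e" for f g :: "'a \<Rightarrow> real"
  proof -
    obtain e where e: "e \<in> E" "Min (g ` E) = g e"
      using Min_in[of "g ` E"] assms by (auto simp del: Min_in)
    moreover have "Min (f ` E) \<le> f e" using e assms by auto
    ultimately show ?thesis by (intro bexI[of _ e]) auto
  qed
  obtain e where e: "e \<in> E" "\<bar>Min (f ` E) - Min (g ` E)\<bar> \<le> \<bar>f e - g e\<bar>"
  proof (cases "Min (g ` E) \<le> Min (f ` E)")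
    case True
    then show ?thesis using main[of f g] that by fastforce
  next
    case False
    then show ?thesis using main[of g f] that by fastforce
  qed
  have "\<bar>Min (f ` E) - Min (g ` E)\<bar> powr p \<le> \<bar>f e - g e\<bar> powr p"
    using e assms by (intro powr_mono2) auto
  also have "\<dots> \<le> (\<Sum>e\<in>E. \<bar>f e - g e\<bar> powr p)"
    by (rule member_le_sum[OF e(1)]) (auto simp: assms)
  finally show ?thesis .
qed

section \<open>Energy densities\<close>

definition energy_density :: "real \<Rightarrow> real \<Rightarrow> ('a::euclidean_space \<Rightarrow> real) \<Rightarrow> 'a \<times> 'a \<Rightarrow> real" where
  "energy_density s p f z =
     \<bar>f (fst z) - f (snd z)\<bar> powr p / norm (fst z - snd z) powr (real DIM('a) + s * p)"

definition weak_integrand ::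
  "real \<Rightarrow> real \<Rightarrow> ('a::euclidean_space \<Rightarrow> real) \<Rightarrow> ('a \<Rightarrow> real) \<Rightarrow> 'a \<times> 'a \<Rightarrow> real" where
  "weak_integrand s p u \<phi> z =
     sgn_pow p (u (fst z) - u (snd z)) * (\<phi> (fst z) - \<phi> (snd z)) /
        norm (fst z - snd z) powr (real DIM('a) + s * p)"

lemma energy_density_nonneg [simp]: "0 \<le> energy_density s p f z"
  by (simp add: energy_density_def)

lemma gagliardo_eq_energy_density:
  "gagliardo s p A f = (\<integral>\<^sup>+z\<in>A \<times> A. ennreal (energy_density s p f z) \<partial>lebesgue)"
  by (simp add: gagliardo_def energy_density_def)

lemma gagliardo_UNIV_eq: "gagliardo s p UNIV f = (\<integral>\<^sup>+z. ennreal (energy_density s p f z) \<partial>lebesgue)"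
  by (simp add: gagliardo_eq_energy_density)

lemma kernel_measurable [measurable]:
  "(\<lambda>z :: 'a::euclidean_space \<times> 'a. norm (fst z - snd z) powr c) \<in> borel_measurable lebesgue"
proof -
  have "(\<lambda>z :: 'a \<times> 'a. norm (fst z - snd z)) \<in> borel_measurable borel"
    by (intro borel_measurable_continuous_onI continuous_intros)
  then have "(\<lambda>z :: 'a \<times> 'a. norm (fst z - snd z) powr c) \<in> borel_measurable borel"
    by measurable
  then show ?thesis by (simp add: measurable_completion)
qed

lemma energy_density_measurable [measurable]:
  assumes [measurable]: "f \<in> borel_measurable lebesgue"
  shows "energy_density s p f \<in> borel_measurable lebesgue"
  unfolding energy_density_def[abs_def] by measurable

lemma weak_integrand_measurable [measurable]:
  assumes [measurable]: "f \<in> borel_measurable lebesgue" "\<phi> \<in> borel_measurable lebesgue"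
  shows "weak_integrand s p f \<phi> \<in> borel_measurable lebesgue"
  unfolding weak_integrand_def[abs_def] sgn_pow_def by measurable

lemma energy_density_translate:
  "energy_density s p (\<lambda>x. f (x - c)) z = energy_density s p f (z - (c, c))"
  by (cases z) (simp add: energy_density_def)

lemma nn_integral_energy_density_translate:
  assumes [measurable]: "f \<in> borel_measurable lebesgue"
  shows "(\<integral>\<^sup>+z. ennreal (energy_density s p (\<lambda>x. f (x - c)) z) \<partial>lebesgue) = gagliardo s p UNIV f"
  unfolding gagliardo_UNIV_eq energy_density_translate
  by (rule nn_integral_lebesgue_translate[where f = "\<lambda>z. ennreal (energy_density s p f z)"]) measurable

lemma Times_sets_lebesgue [measurable]:
  assumes "A \<in> sets lebesgue"
  shows "A \<times> A \<in> sets lebesgue"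
proof -
  have "A \<times> A = fst -` A \<inter> snd -` A" by auto
  then show ?thesis
    using measurable_sets[OF measurable_lebesgue_fst_snd(1) assms]
      measurable_sets[OF measurable_lebesgue_fst_snd(2) assms] by auto
qed

lemma set_energy_density_measurable [measurable]:
  assumes [measurable]: "f \<in> borel_measurable lebesgue" "A \<in> sets lebesgue"
  shows "(\<lambda>z. ennreal (energy_density s p f z) * indicator (A \<times> A) z) \<in> borel_measurable lebesgue"
proof -
  have [measurable]: "A \<times> A \<in> sets lebesgue" by (rule Times_sets_lebesgue) measurable
  show ?thesis by measurable
qed

text \<open>Only the local energy of \<open>w\<close> is known to be finite, so the position of
  \<open>y\<close> decides the bound. For \<open>y\<close> in \<open>A'\<close> the local energy
  suffices; for \<open>y\<close> in \<Omega> outside \<open>A'\<close> the points are at least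
  \<eta> apart and \<open>p\<close>-th powers suffice; for \<open>y\<close> outside \<Omega> both
  functions vanish at \<open>y\<close> and \<open>h\<close>, with globally finite energy,
  dominates.\<close>

lemma weak_integrand_bound_aux:
  fixes x y :: "'a::euclidean_space"
  assumes p: "1 < p" and s: "0 < s" and \<eta>: "0 < \<eta>" and A: "A \<subseteq> \<Omega>" "\<And>x. x \<in> A \<Longrightarrow> ball x \<eta> \<subseteq> A'"
    and w0: "\<And>x. x \<notin> \<Omega> \<Longrightarrow> w x = 0" and h0: "\<And>x. x \<notin> \<Omega> \<Longrightarrow> h x = 0"
    and x: "x \<in> A" "\<bar>w x\<bar> \<le> 2 * \<bar>h x\<bar>"
  shows "\<bar>w x - w y\<bar> powr p / norm (x - y) powr (real DIM('a) + s * p) \<le>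
    2 powr p * (\<bar>h x - h y\<bar> powr p / norm (x - y) powr (real DIM('a) + s * p))
    + \<bar>w x - w y\<bar> powr p / norm (x - y) powr (real DIM('a) + s * p) * indicator (A' \<times> A') (x, y)
    + 2 powr p / \<eta> powr (real DIM('a) + s * p) *
       (\<bar>w x\<bar> powr p * indicator \<Omega> y + indicator \<Omega> x * \<bar>w y\<bar> powr p)"
    (is "?L / ?K \<le> ?a + ?b + ?c")
proof -
  have nn: "0 \<le> ?a" "0 \<le> ?b" "0 \<le> ?c" by (simp_all add: indicator_def)
  have q: "0 < real DIM('a) + s * p" using s p by (intro add_pos_pos) auto
  consider "y \<in> A'" | "y \<notin> A'" "y \<in> \<Omega>" | "y \<notin> \<Omega>" by blast
  then show ?thesis
  proof cases
    case 1
    have "x \<in> A'" using A(2)[OF x(1)] \<eta> by auto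
    with 1 have "?L / ?K = ?b" by simp
    with nn show ?thesis by linarith
  next
    case 2
    have "\<not> dist x y < \<eta>" using A(2)[OF x(1)] 2 by auto
    then have K: "\<eta> powr (real DIM('a) + s * p) \<le> ?K"
      using \<eta> q by (intro powr_mono2) (auto simp: dist_norm)
    have "?L / ?K \<le> ?L / \<eta> powr (real DIM('a) + s * p)"
      using K \<eta> by (intro divide_left_mono mult_pos_pos) (auto intro: less_le_trans)
    also have "\<dots> \<le> 2 powr p * (\<bar>w x\<bar> powr p + \<bar>w y\<bar> powr p) / \<eta> powr (real DIM('a) + s * p)"
      using p by (intro divide_right_mono abs_diff_powr_le) auto
    also have "\<dots> = ?c" using 2 x A by auto
    finally show ?thesis using nn by linarith
  next
    case 3
    have "?L = \<bar>w x\<bar> powr p" using 3 w0 by simp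
    also have "\<dots> \<le> (2 * \<bar>h x\<bar>) powr p" using x p by (intro powr_mono2) auto
    also have "\<dots> = 2 powr p * \<bar>h x - h y\<bar> powr p" using 3 h0 by (simp add: powr_mult)
    finally have "?L / ?K \<le> 2 powr p * \<bar>h x - h y\<bar> powr p / ?K" by (intro divide_right_mono) auto
    then have "?L / ?K \<le> ?a" by simp
    with nn show ?thesis by linarith
  qed
qed

text \<open>The integrand vanishes unless \<phi> differs at the two points, and then one of them
  lies in \<open>A\<close>. Young's inequality splits off the energy of \<phi>, and the three-case
  bound at the point in \<open>A\<close> controls the increments of \<open>w\<close>.\<close>

lemma integrable_weak_integrand:
  fixes w \<phi> h :: "'a::euclidean_space \<Rightarrow> real"
  assumes p: "1 < p" and s: "0 < s"
    and meas [measurable]: "w \<in> borel_measurable lebesgue" "\<phi> \<in> borel_measurable lebesgue" "h \<in> borel_measurable lebesgue"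
    and g: "gagliardo s p UNIV \<phi> < \<infinity>" "gagliardo s p UNIV h < \<infinity>" "gagliardo s p A' w < \<infinity>"
    and Lp: "(\<integral>\<^sup>+x. ennreal (\<bar>w x\<bar> powr p) \<partial>lebesgue) < \<infinity>"
    and \<Omega> [measurable]: "\<Omega> \<in> sets lebesgue" and \<Omega>fin: "emeasure lebesgue \<Omega> < \<infinity>" and A' [measurable]: "A' \<in> sets lebesgue"
    and \<eta>: "0 < \<eta>" and A: "A \<subseteq> \<Omega>" "\<And>x. x \<in> A \<Longrightarrow> ball x \<eta> \<subseteq> A'"
    and w0: "\<And>x. x \<notin> \<Omega> \<Longrightarrow> w x = 0" and h0: "\<And>x. x \<notin> \<Omega> \<Longrightarrow> h x = 0"
    and \<phi>: "AE x in lebesgue. \<phi> x \<noteq> 0 \<longrightarrow> x \<in> A \<and> \<bar>w x\<bar> \<le> 2 * \<bar>h x\<bar>"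
  shows "integrable lebesgue (weak_integrand s p w \<phi>)"
proof (rule integrableI_bounded)
  show "weak_integrand s p w \<phi> \<in> borel_measurable lebesgue" by measurable
  let ?q = "real DIM('a) + s * p"
  define c where "c = 2 powr p / \<eta> powr ?q"
  define e4 where "e4 z = ennreal (\<bar>w (fst z)\<bar> powr p) * indicator \<Omega> (snd z)
    + indicator \<Omega> (fst z) * ennreal (\<bar>w (snd z)\<bar> powr p)" for z
  have c: "0 \<le> c" by (simp add: c_def)
  have m1: "(\<lambda>z. ennreal (\<bar>w (fst z)\<bar> powr p) * indicator \<Omega> (snd z :: 'a)) \<in> borel_measurable lebesgue"
    and m2: "(\<lambda>z. indicator \<Omega> (fst z :: 'a) * ennreal (\<bar>w (snd z)\<bar> powr p)) \<in> borel_measurable lebesgue"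
    by (intro borel_measurable_times_ennreal borel_measurable_lebesgue_fst_snd
        borel_measurable_lebesgue_fst_snd[where f = "\<lambda>x. ennreal (\<bar>w x\<bar> powr p)"]; measurable)+
  have [measurable]: "e4 \<in> borel_measurable lebesgue"
    unfolding e4_def[abs_def] by (intro borel_measurable_add m1 m2)
  have e4: "(\<integral>\<^sup>+z. e4 z \<partial>lebesgue) < \<infinity>"
    unfolding e4_def nn_integral_add[OF m1 m2]
    using nn_integral_lebesgue_fst_mult_snd[of "\<lambda>x. ennreal (\<bar>w x\<bar> powr p)" "indicator \<Omega>"]
      nn_integral_lebesgue_fst_mult_snd[of "indicator \<Omega>" "\<lambda>x. ennreal (\<bar>w x\<bar> powr p)"]
      Lp \<Omega>fin \<Omega> by (simp add: ennreal_mult_less_top)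
  let ?H = "\<lambda>z. ennreal (energy_density s p \<phi> z) + (ennreal (2 powr p) * ennreal (energy_density s p h z)
    + (ennreal (energy_density s p w z) * indicator (A' \<times> A') z + ennreal c * e4 z))"
  have fin: "(\<integral>\<^sup>+z. ?H z \<partial>lebesgue) < \<infinity>"
  proof -
    have n: "(\<lambda>z. ennreal (energy_density s p w z) * indicator (A' \<times> A') z) \<in> borel_measurable lebesgue"
      by measurable
    have "(\<integral>\<^sup>+z. ?H z \<partial>lebesgue) = gagliardo s p UNIV \<phi> + (ennreal (2 powr p) * gagliardo s p UNIV h
      + (gagliardo s p A' w + ennreal c * (\<integral>\<^sup>+z. e4 z \<partial>lebesgue)))"
      unfolding gagliardo_UNIV_eq gagliardo_eq_energy_density[of _ _ A']
      using n by (subst nn_integral_add nn_integral_cmult; measurable)+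
    then show ?thesis using g e4 by (simp add: ennreal_mult_less_top)
  qed
  have "AE z in lebesgue. ennreal (norm (weak_integrand s p w \<phi> z)) \<le> ?H z"
    using AE_lebesgue_fst_snd[OF \<phi>]
  proof eventually_elim
    case (elim z)
    obtain x y where z: "z = (x, y)" by fastforce
    let ?K = "norm (x - y) powr ?q"
    let ?W = "\<bar>w x - w y\<bar> powr p / ?K"
    let ?R = "2 powr p * energy_density s p h z + energy_density s p w z * indicator (A' \<times> A') z
      + c * (\<bar>w x\<bar> powr p * indicator \<Omega> y + indicator \<Omega> x * \<bar>w y\<bar> powr p)"
    have R0: "0 \<le> ?R" using c by (simp add: indicator_def)
    have "norm (weak_integrand s p w \<phi> z) \<le> energy_density s p \<phi> z + ?R"
    proof (cases "\<phi> x = \<phi> y")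
      case True
      then have "weak_integrand s p w \<phi> z = 0" by (simp add: weak_integrand_def z)
      with R0 show ?thesis by (simp add: add_nonneg_nonneg)
    next
      case False
      have W: "?W \<le> ?R"
      proof (cases "\<phi> x = 0")
        case True
        with False elim z have "y \<in> A" "\<bar>w y\<bar> \<le> 2 * \<bar>h y\<bar>" by auto
        from weak_integrand_bound_aux[of p s \<eta> A \<Omega> A' w h y x, OF p s \<eta> A w0 h0 this]
        show ?thesis
          by (simp add: energy_density_def z c_def norm_minus_commute abs_minus_commute indicator_times algebra_simps)
      next
        case False
        with elim z have "x \<in> A" "\<bar>w x\<bar> \<le> 2 * \<bar>h x\<bar>" by auto
        from weak_integrand_bound_aux[of p s \<eta> A \<Omega> A' w h x y, OF p s \<eta> A w0 h0 this]
        show ?thesis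
          by (simp add: energy_density_def z c_def)
      qed
      have "norm (weak_integrand s p w \<phi> z) = \<bar>w x - w y\<bar> powr (p - 1) * \<bar>\<phi> x - \<phi> y\<bar> / ?K"
        by (simp add: weak_integrand_def z abs_mult abs_sgn_pow)
      also have "\<dots> \<le> (\<bar>w x - w y\<bar> powr p + \<bar>\<phi> x - \<phi> y\<bar> powr p) / ?K"
        using p by (intro divide_right_mono powr_mult_le_sum_powr) auto
      also have "\<dots> = ?W + energy_density s p \<phi> z"
        by (simp add: energy_density_def z add_divide_distrib)
      finally show ?thesis using W by linarith
    qed
    then have "ennreal (norm (weak_integrand s p w \<phi> z)) \<le> ennreal (energy_density s p \<phi> z + ?R)"
      by (rule ennreal_leI)
    also have "\<dots> = ?H z"
      using c by (simp add: z e4_def ennreal_plus ennreal_mult indicator_def add.assoc)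
    finally show ?case .
  qed
  then have "(\<integral>\<^sup>+z. ennreal (norm (weak_integrand s p w \<phi> z)) \<partial>lebesgue) \<le> (\<integral>\<^sup>+z. ?H z \<partial>lebesgue)"
    by (rule nn_integral_mono_AE)
  with fin show "(\<integral>\<^sup>+z. ennreal (norm (weak_integrand s p w \<phi> z)) \<partial>lebesgue) < \<infinity>"
    by (rule order.strict_trans1[rotated])
qed

text \<open>If both points lie in \<open>A'\<close>, the increment is bounded by those of
  \<open>a\<close> and \<open>v\<close>. Otherwise one point is outside \<open>A\<close>, where
  \<open>a\<close> and the truncation vanish, and the truncation lies between 0 and \<open>a\<close>
  at the other, so the increment of \<open>a\<close> alone suffices. Hence only the local energy of
  \<open>v\<close> enters.\<close>

lemma W_sp_0_max_diff:
  fixes a v :: "'a::euclidean_space \<Rightarrow> real"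
  assumes p: "1 < p" and meas [measurable]: "a \<in> borel_measurable lebesgue" "v \<in> borel_measurable lebesgue"
    and a: "in_Lp p UNIV a" "gagliardo s p UNIV a < \<infinity>" "\<And>x. x \<notin> A \<Longrightarrow> a x = 0" "\<And>x. 0 \<le> a x"
    and v: "AE x in lebesgue. 0 \<le> v x" "gagliardo s p A' v < \<infinity>"
    and A: "A \<subseteq> A'" and A' [measurable]: "A' \<in> sets lebesgue"
  shows "(\<lambda>x. max (a x - v x) 0) \<in> W_sp_0 s p A"
proof -
  let ?\<phi> = "\<lambda>x. max (a x - v x) 0"
  have L: "in_Lp p UNIV ?\<phi>"
    unfolding in_Lp_def lebesgue_on_UNIV_eq
  proof
    show "integrable lebesgue (\<lambda>x. \<bar>?\<phi> x\<bar> powr p)"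
    proof (rule Bochner_Integration.integrable_bound)
      show "integrable lebesgue (\<lambda>x. \<bar>a x\<bar> powr p)" using a(1) by (simp add: in_Lp_def lebesgue_on_UNIV_eq)
      show "AE x in lebesgue. norm (\<bar>?\<phi> x\<bar> powr p) \<le> norm (\<bar>a x\<bar> powr p)"
        using v(1)
      proof eventually_elim
        case (elim x)
        have "\<bar>?\<phi> x\<bar> \<le> \<bar>a x\<bar>" using elim a(4)[of x] by auto
        then show ?case using p by (auto intro!: powr_mono2)
      qed
    qed measurable
  qed measurable
  have "gagliardo s p UNIV ?\<phi> \<le> (\<integral>\<^sup>+z. ennreal (2 powr p) * (ennreal (energy_density s p a z)
      + ennreal (energy_density s p v z) * indicator (A' \<times> A') z) \<partial>lebesgue)"
    unfolding gagliardo_UNIV_eq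
  proof (rule nn_integral_mono_AE)
    show "AE z in lebesgue. ennreal (energy_density s p ?\<phi> z) \<le> ennreal (2 powr p) * (ennreal (energy_density s p a z)
      + ennreal (energy_density s p v z) * indicator (A' \<times> A') z)"
      using AE_lebesgue_fst_snd[OF v(1)]
    proof eventually_elim
      case (elim z)
      obtain x y where z: "z = (x, y)" by fastforce
      let ?K = "norm (x - y) powr (real DIM('a) + s * p)"
      let ?b = "\<bar>v x - v y\<bar> powr p * indicator (A' \<times> A') (x, y)"
      have "\<bar>?\<phi> x - ?\<phi> y\<bar> powr p \<le> 2 powr p * (\<bar>a x - a y\<bar> powr p + ?b)"
      proof (cases "x \<in> A' \<and> y \<in> A'")
        case True
        have "\<bar>?\<phi> x - ?\<phi> y\<bar> powr p \<le> \<bar>(a x - a y) - (v x - v y)\<bar> powr p"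
          using p by (intro powr_mono2) auto
        also have "\<dots> \<le> 2 powr p * (\<bar>a x - a y\<bar> powr p + \<bar>v x - v y\<bar> powr p)"
          using p by (intro abs_diff_powr_le) auto
        finally show ?thesis using True by simp
      next
        case False
        then have "x \<notin> A \<or> y \<notin> A" using A by auto
        then have "\<bar>?\<phi> x - ?\<phi> y\<bar> \<le> \<bar>a x - a y\<bar>"
          using elim z a(3)[of x] a(3)[of y] a(4)[of x] a(4)[of y] by auto
        then have "\<bar>?\<phi> x - ?\<phi> y\<bar> powr p \<le> \<bar>a x - a y\<bar> powr p"
          using p by (intro powr_mono2) auto
        also have "\<dots> \<le> 2 powr p * \<bar>a x - a y\<bar> powr p"
          using p by (simp add: mult_left_le_one_le ge_one_powr_ge_zero mult_le_cancel_right1)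
        finally show ?thesis using False by auto
      qed
      then have "\<bar>?\<phi> x - ?\<phi> y\<bar> powr p / ?K \<le> 2 powr p * (\<bar>a x - a y\<bar> powr p + ?b) / ?K"
        by (rule divide_right_mono) simp
      also have "\<dots> = 2 powr p * (energy_density s p a z + energy_density s p v z * indicator (A' \<times> A') z)"
        by (simp add: energy_density_def z add_divide_distrib distrib_left)
      finally have "energy_density s p ?\<phi> z \<le> \<dots>" by (simp add: energy_density_def z)
      then have "ennreal (energy_density s p ?\<phi> z) \<le> ennreal (2 powr p * (energy_density s p a z + energy_density s p v z * indicator (A' \<times> A') z))"
        by (rule ennreal_leI)
      also have "\<dots> = ennreal (2 powr p) * (ennreal (energy_density s p a z)
        + ennreal (energy_density s p v z) * indicator (A' \<times> A') z)"
        by (simp add: ennreal_mult ennreal_plus indicator_def)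
      finally show ?case .
    qed
  qed
  also have "\<dots> = ennreal (2 powr p) * (gagliardo s p UNIV a + gagliardo s p A' v)"
  proof -
    have n: "(\<lambda>z. ennreal (energy_density s p v z) * indicator (A' \<times> A') z) \<in> borel_measurable lebesgue"
      by measurable
    then show ?thesis
      unfolding gagliardo_UNIV_eq gagliardo_eq_energy_density[of _ _ A']
      by (subst nn_integral_add[symmetric] nn_integral_cmult; measurable)+
  qed
  also have "\<dots> < \<infinity>" using a(2) v(2) by (simp add: ennreal_mult_less_top)
  finally have "gagliardo s p UNIV ?\<phi> < \<infinity>" .
  moreover have "AE x in lebesgue. x \<notin> A \<longrightarrow> ?\<phi> x = 0"
    using v(1) by eventually_elim (auto simp: a(3))
  ultimately show ?thesis using L by (simp add: W_sp_0_def W_sp_def)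
qed

lemma energy_density_Min_translates_le:
  fixes \<psi> :: "'a::euclidean_space \<Rightarrow> real"
  assumes "finite E" "E \<noteq> {}" "1 < p"
  shows "energy_density s p (\<lambda>x. Min ((\<lambda>e. \<psi> (x - t *\<^sub>R e)) ` E)) z
    \<le> (\<Sum>e\<in>E. energy_density s p (\<lambda>x. \<psi> (x - t *\<^sub>R e)) z)"
  unfolding energy_density_def sum_divide_distrib[symmetric]
  using assms by (intro divide_right_mono abs_Min_image_diff_powr_le) auto

section \<open>Admissible functions\<close>

text \<open>The union is the Minkowski sum of \<open>C\<close> and a closed ball, hence
  compact.\<close>

lemma compact_UN_cball:
  fixes C :: "'a::euclidean_space set"
  assumes "compact C"
  shows "compact (\<Union>x\<in>C. cball x r)"
proof -
  have "(\<Union>x\<in>C. cball x r) = {x + y | x y. x \<in> C \<and> y \<in> cball 0 r}"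
  proof (intro equalityI subsetI)
    fix z assume "z \<in> (\<Union>x\<in>C. cball x r)"
    then obtain x where "x \<in> C" "norm (z - x) \<le> r" by (auto simp: dist_norm norm_minus_commute)
    then show "z \<in> {x + y | x y. x \<in> C \<and> y \<in> cball 0 r}"
      by (intro CollectI exI[of _ x] exI[of _ "z - x"]) auto
  next
    fix z assume "z \<in> {x + y | x y. x \<in> C \<and> y \<in> cball 0 r}"
    then obtain x y where "z = x + y" "x \<in> C" "norm y \<le> r" by auto
    then have "x \<in> C" "z \<in> cball x r" by (simp_all add: dist_norm)
    then show "z \<in> (\<Union>x\<in>C. cball x r)" by blast
  qed
  then show ?thesis using compact_sums[OF assms compact_cball[of 0 r]] by simp
qed

lemma compactly_contained_UN_ball:
  fixes C :: "'a::euclidean_space set"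
  assumes "compact C" "(\<Union>x\<in>C. cball x r) \<subseteq> \<Omega>"
  shows "compactly_contained (\<Union>x\<in>C. ball x r) \<Omega>"
proof -
  have "closure (\<Union>x\<in>C. ball x r) \<subseteq> (\<Union>x\<in>C. cball x r)"
    using compact_UN_cball[OF assms(1), of r] by (intro closure_minimal compact_imp_closed) auto
  moreover have "bounded (\<Union>x\<in>C. ball x r)"
    by (rule bounded_subset[OF compact_imp_bounded[OF compact_UN_cball[OF assms(1), of r]]]) auto
  ultimately show ?thesis using assms(2) by (auto simp: compactly_contained_def)
qed

lemma compact_neighbourhoods:
  fixes C :: "'a::euclidean_space set"
  assumes "compact C" "open \<Omega>" "C \<subseteq> \<Omega>"
  obtains A A' \<eta> where "open A" "open A'" "compactly_contained A \<Omega>" "compactly_contained A' \<Omega>"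
    "C \<subseteq> A" "A \<subseteq> A'" "0 < \<eta>" "\<forall>x\<in>A. ball x \<eta> \<subseteq> A'"
proof -
  obtain e where e: "0 < e" "(\<Union>x\<in>C. cball x e) \<subseteq> \<Omega>"
    using compact_subset_open_imp_cball_epsilon_subset[OF assms] by blast
  have sub: "(\<Union>x\<in>C. cball x (e / 2)) \<subseteq> (\<Union>x\<in>C. cball x e)" using e by auto
  show ?thesis
  proof (rule that[of "\<Union>x\<in>C. ball x (e / 2)" "\<Union>x\<in>C. ball x e" "e / 2"])
    show "compactly_contained (\<Union>x\<in>C. ball x (e / 2)) \<Omega>"
      using compactly_contained_UN_ball[OF assms(1)] sub e by blast
    show "compactly_contained (\<Union>x\<in>C. ball x e) \<Omega>"
      by (rule compactly_contained_UN_ball[OF assms(1) e(2)])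
    show "\<forall>x\<in>(\<Union>x\<in>C. ball x (e / 2)). ball x (e / 2) \<subseteq> (\<Union>x\<in>C. ball x e)"
    proof (intro ballI subsetI)
      fix x y assume x: "x \<in> (\<Union>x\<in>C. ball x (e / 2))" and y: "y \<in> ball x (e / 2)"
      from x obtain c where c: "c \<in> C" "dist c x < e / 2" by auto
      then have "dist c y < e" using dist_triangle[of c y x] y by simp
      with c show "y \<in> (\<Union>x\<in>C. ball x e)" by auto
    qed
  qed (use e in auto)
qed

text \<open>Positivity is known almost everywhere on each compactly contained set. Countably many
  boxes exhaust \<Omega>, so the exceptional null sets can be united.\<close>

lemma admissible_AE_nonneg:
  assumes "open \<Omega>" and u: "admissible s p \<Omega> u"
  shows "AE x in lebesgue. 0 \<le> u x"
proof (rule open_countable_Union_open_cbox[OF assms(1)])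
  fix \<D>
  assume D: "countable \<D>" "\<D> \<subseteq> Pow \<Omega>" "\<Union>\<D> = \<Omega>"
    and cbox: "\<And>X. X \<in> \<D> \<Longrightarrow> \<exists>a b. X = cbox a b"
  have "AE x in lebesgue. x \<in> X \<longrightarrow> 0 \<le> u x" if X: "X \<in> \<D>" for X
  proof -
    have "compact X" using cbox[OF X] by (elim exE) (simp add: compact_cbox)
    moreover have "X \<subseteq> \<Omega>" using D(2) X by auto
    ultimately have "compactly_contained X \<Omega>"
      by (simp add: compactly_contained_def compact_imp_closed)
    then have "\<exists>c>0. AE x in lebesgue. x \<in> X \<longrightarrow> c \<le> u x"
      using u by (simp add: admissible_def)
    then obtain c where "0 < c" and ae: "AE x in lebesgue. x \<in> X \<longrightarrow> c \<le> u x" by auto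
    show ?thesis using ae by eventually_elim (use \<open>0 < c\<close> in auto)
  qed
  then have "AE x in lebesgue. \<forall>X\<in>\<D>. x \<in> X \<longrightarrow> 0 \<le> u x"
    by (intro AE_ball_countable' D(1))
  then show ?thesis
  proof eventually_elim
    case (elim x)
    show ?case
    proof (cases "x \<in> \<Omega>")
      case True
      then obtain X where "X \<in> \<D>" "x \<in> X" using D(3) by auto
      with elim show ?thesis by blast
    next
      case False
      then show ?thesis using u by (simp add: admissible_def)
    qed
  qed
qed

text \<open>Membership in the local space only gives measurability on compactly contained sets.
  Globally, \<open>u\<close> agrees almost everywhere with the root of the measurable function
  \<open>u powr \<kappa>\<close>.\<close>

lemma admissible_measurable:
  assumes "open \<Omega>" and u: "admissible s p \<Omega> u"
  shows "u \<in> borel_measurable lebesgue"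
proof -
  obtain \<kappa> where \<kappa>: "1 \<le> \<kappa>" "(\<lambda>x. u x powr \<kappa>) \<in> W_sp_0 s p \<Omega>"
    using u by (auto simp: admissible_def)
  then have "(\<lambda>x. u x powr \<kappa>) \<in> borel_measurable lebesgue"
    by (auto simp: W_sp_0_def W_sp_def in_Lp_def lebesgue_on_UNIV_eq)
  then have "(\<lambda>x. (u x powr \<kappa>) powr (1 / \<kappa>)) \<in> borel_measurable lebesgue"
    by (rule powr_real_measurable[OF _ borel_measurable_const])
  moreover have "AE x in lebesgue. (u x powr \<kappa>) powr (1 / \<kappa>) = u x"
    using admissible_AE_nonneg[OF assms] by eventually_elim (use \<kappa>(1) in \<open>simp add: powr_powr\<close>)
  ultimately show ?thesis by (rule borel_measurable_AE)
qed

text \<open>For nonnegative \<open>t\<close> one has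
  \<open>t powr p \<le> 1 + t powr (\<kappa> * p)\<close>; the constant is integrable over the
  bounded set \<Omega>.\<close>

lemma admissible_Lp:
  assumes "open \<Omega>" "bounded \<Omega>" "1 < p" and u: "admissible s p \<Omega> u"
  shows "(\<integral>\<^sup>+x. ennreal (\<bar>u x\<bar> powr p) \<partial>lebesgue) < \<infinity>"
proof -
  obtain \<kappa> where \<kappa>: "1 \<le> \<kappa>" "(\<lambda>x. u x powr \<kappa>) \<in> W_sp_0 s p \<Omega>"
    using u by (auto simp: admissible_def)
  then have int: "integrable lebesgue (\<lambda>x. \<bar>u x powr \<kappa>\<bar> powr p)"
    by (auto simp: W_sp_0_def W_sp_def in_Lp_def lebesgue_on_UNIV_eq)
  then have m: "(\<lambda>x. ennreal (\<bar>u x powr \<kappa>\<bar> powr p)) \<in> borel_measurable lebesgue"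
    by (intro measurable_compose[OF _ measurable_ennreal] borel_measurable_integrable)
  have \<Omega>: "\<Omega> \<in> sets lebesgue" using assms(1) by simp
  have "(\<integral>\<^sup>+x. ennreal (\<bar>u x\<bar> powr p) \<partial>lebesgue)
    \<le> (\<integral>\<^sup>+x. indicator \<Omega> x + ennreal (\<bar>u x powr \<kappa>\<bar> powr p) \<partial>lebesgue)"
  proof (rule nn_integral_mono_AE)
    show "AE x in lebesgue. ennreal (\<bar>u x\<bar> powr p) \<le> indicator \<Omega> x + ennreal (\<bar>u x powr \<kappa>\<bar> powr p)"
      using admissible_AE_nonneg[OF assms(1) u]
    proof eventually_elim
      case (elim x)
      show ?case
      proof (cases "x \<in> \<Omega>")
        case False
        then have "u x = 0" using u by (simp add: admissible_def)
        then show ?thesis by simp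
      next
        case True
        have "u x powr p \<le> 1 + (u x powr \<kappa>) powr p"
        proof (cases "u x \<le> 1")
          case True
          then have "u x powr p \<le> 1 powr p" using elim assms(3) by (intro powr_mono2) auto
          then show ?thesis by (simp add: add_increasing2)
        next
          case False
          then have "u x powr p \<le> u x powr (\<kappa> * p)" using \<kappa>(1) assms(3) by (intro powr_mono) auto
          then show ?thesis by (simp add: powr_powr)
        qed
        then have "ennreal (u x powr p) \<le> ennreal (1 + (u x powr \<kappa>) powr p)" by (rule ennreal_leI)
        then show ?thesis using True elim by (simp add: ennreal_plus)
      qed
    qed
  qed
  also have "\<dots> = emeasure lebesgue \<Omega> + (\<integral>\<^sup>+x. ennreal (\<bar>u x powr \<kappa>\<bar> powr p) \<partial>lebesgue)"
    by (subst nn_integral_add[OF borel_measurable_indicator[OF \<Omega>] m]) (simp add: \<Omega>)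
  also have "\<dots> < \<infinity>"
  proof -
    have "emeasure lebesgue \<Omega> < \<infinity>"
      using bounded_set_imp_lmeasurable[OF assms(2)] assms(1) by (auto simp: fmeasurable_def)
    moreover have "(\<integral>\<^sup>+x. ennreal (\<bar>u x powr \<kappa>\<bar> powr p) \<partial>lebesgue) < \<infinity>"
      using int by (simp add: integrable_iff_bounded)
    ultimately show ?thesis by simp
  qed
  finally show ?thesis .
qed

text \<open>Global energy is assumed only for \<open>u powr \<kappa>\<close>; the Lipschitz bound
  for truncation at a positive level transfers it, at the cost of a factor depending on
  \<open>e\<close>.\<close>

lemma admissible_truncation:
  assumes "open \<Omega>" "bounded \<Omega>" "1 < p" and u: "admissible s p \<Omega> u" and e: "0 < e"
  shows "in_Lp p UNIV (\<lambda>x. max (u x - e) 0)" "gagliardo s p UNIV (\<lambda>x. max (u x - e) 0) < \<infinity>"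
    "(\<lambda>x. max (u x - e) 0) \<in> borel_measurable lebesgue"
proof -
  note nn = admissible_AE_nonneg[OF assms(1) u]
  note mu = admissible_measurable[OF assms(1) u]
  obtain \<kappa> where \<kappa>: "1 \<le> \<kappa>" "(\<lambda>x. u x powr \<kappa>) \<in> W_sp_0 s p \<Omega>"
    using u by (auto simp: admissible_def)
  then have g: "gagliardo s p UNIV (\<lambda>x. u x powr \<kappa>) < \<infinity>" by (simp add: W_sp_0_def W_sp_def)
  show m: "(\<lambda>x. max (u x - e) 0) \<in> borel_measurable lebesgue"
    by (intro borel_measurable_max borel_measurable_diff mu borel_measurable_const)
  have "(\<integral>\<^sup>+x. ennreal (\<bar>max (u x - e) 0\<bar> powr p) \<partial>lebesgue) \<le> (\<integral>\<^sup>+x. ennreal (\<bar>u x\<bar> powr p) \<partial>lebesgue)"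
  proof (intro nn_integral_mono ennreal_leI powr_mono2)
    show "\<bar>max (u x - e) 0\<bar> \<le> \<bar>u x\<bar>" for x using e by auto
  qed (use assms(3) in auto)
  also note admissible_Lp[OF assms(1-3) u]
  finally have "integrable lebesgue (\<lambda>x. \<bar>max (u x - e) 0\<bar> powr p)"
    by (intro integrableI_bounded powr_real_measurable borel_measurable_abs m borel_measurable_const) simp
  then show "in_Lp p UNIV (\<lambda>x. max (u x - e) 0)"
    using m by (simp add: in_Lp_def lebesgue_on_UNIV_eq)
  let ?c = "(e powr (1 - \<kappa>)) powr p"
  have mk: "(\<lambda>x. u x powr \<kappa>) \<in> borel_measurable lebesgue"
    by (intro powr_real_measurable mu borel_measurable_const)
  have "gagliardo s p UNIV (\<lambda>x. max (u x - e) 0)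
    \<le> (\<integral>\<^sup>+z. ennreal ?c * ennreal (energy_density s p (\<lambda>x. u x powr \<kappa>) z) \<partial>lebesgue)"
    unfolding gagliardo_UNIV_eq
  proof (rule nn_integral_mono_AE)
    show "AE z in lebesgue. ennreal (energy_density s p (\<lambda>x. max (u x - e) 0) z)
        \<le> ennreal ?c * ennreal (energy_density s p (\<lambda>x. u x powr \<kappa>) z)"
      using AE_lebesgue_fst_snd[OF nn]
    proof eventually_elim
      case (elim z)
      let ?d = "\<lambda>x. max (u x - e) 0"
      have "\<bar>?d (fst z) - ?d (snd z)\<bar> powr p
          \<le> (e powr (1 - \<kappa>) * \<bar>u (fst z) powr \<kappa> - u (snd z) powr \<kappa>\<bar>) powr p"
        using elim assms(3) by (intro powr_mono2 abs_diff_max_le_powr e \<kappa>) auto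
      also have "\<dots> = ?c * \<bar>u (fst z) powr \<kappa> - u (snd z) powr \<kappa>\<bar> powr p"
        by (simp add: powr_mult)
      finally have "energy_density s p ?d z \<le> ?c * energy_density s p (\<lambda>x. u x powr \<kappa>) z"
        unfolding energy_density_def times_divide_eq_right by (intro divide_right_mono) auto
      then have "ennreal (energy_density s p ?d z) \<le> ennreal (?c * energy_density s p (\<lambda>x. u x powr \<kappa>) z)"
        by (rule ennreal_leI)
      then show ?case by (simp add: ennreal_mult)
    qed
  qed
  also have "\<dots> = ennreal ?c * gagliardo s p UNIV (\<lambda>x. u x powr \<kappa>)"
    unfolding gagliardo_UNIV_eq
    by (rule nn_integral_cmult[OF measurable_compose[OF energy_density_measurable[OF mk] measurable_ennreal]])
  also have "\<dots> < \<infinity>" using g by (simp add: ennreal_mult_less_top)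
  finally show "gagliardo s p UNIV (\<lambda>x. max (u x - e) 0) < \<infinity>" .
qed

text \<open>Where \<phi> is nonzero, \<open>v \<le> u\<close>, and dividing by a larger power
  decreases the quotient since \<open>K\<close> is nonnegative. On the compact set \<open>C\<close>
  the weight is bounded and \<open>v\<close> stays above \<open>c\<close>, which gives an integrable
  majorant.\<close>

lemma singular_term_mono:
  fixes \<Omega> :: "'a::euclidean_space set"
  assumes \<Omega>: "open \<Omega>" and p: "1 < p" and \<gamma>: "0 \<le> \<gamma>"
    and K: "K \<in> borel_measurable (lebesgue_on \<Omega>)" "\<And>x. x \<in> \<Omega> \<Longrightarrow> 0 \<le> K x"
    and C: "compact C" "C \<subseteq> \<Omega>" and KC: "\<And>x. x \<in> C \<Longrightarrow> K x \<le> M"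
    and v [measurable]: "v \<in> borel_measurable lebesgue" and c: "0 < c" "AE x in lebesgue. x \<in> C \<longrightarrow> c \<le> v x"
    and a: "in_Lp p UNIV a"
    and \<phi> [measurable]: "\<phi> \<in> borel_measurable lebesgue"
    and \<phi>a: "AE x in lebesgue. 0 \<le> \<phi> x \<and> \<phi> x \<le> \<bar>a x\<bar> \<and> (\<phi> x \<noteq> 0 \<longrightarrow> x \<in> C \<and> v x \<le> u x)"
  shows "singular_term \<Omega> K \<gamma> u \<phi> \<le> singular_term \<Omega> K \<gamma> v \<phi>"
proof -
  have [measurable]: "\<Omega> \<in> sets lebesgue" using \<Omega> by simp
  have [measurable]: "C \<in> sets lebesgue" using C(1) by (simp add: compact_imp_closed)
  have AEr: "(AE x in lebesgue_on \<Omega>. P x) \<longleftrightarrow> (AE x in lebesgue. x \<in> \<Omega> \<longrightarrow> P x)" for P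
    by (rule AE_restrict_space_iff) simp
  have ae: "AE x in lebesgue_on \<Omega>. x \<in> \<Omega> \<and> 0 \<le> \<phi> x \<and> \<phi> x \<le> \<bar>a x\<bar>
    \<and> (\<phi> x \<noteq> 0 \<longrightarrow> x \<in> C \<and> v x \<le> u x \<and> c \<le> v x)"
    unfolding AEr using c(2) \<phi>a by eventually_elim auto
  have meas: "v \<in> borel_measurable (lebesgue_on \<Omega>)" "\<phi> \<in> borel_measurable (lebesgue_on \<Omega>)"
    by (intro measurable_restrict_space1 v \<phi>)+
  define M' where "M' = max M 0 / c powr \<gamma>"
  have M': "0 \<le> M'" by (simp add: M'_def)
  have "integrable lebesgue (\<lambda>x. M' * (indicator C x + \<bar>a x\<bar> powr p))"
  proof -
    have "integrable lebesgue (indicator C :: 'a \<Rightarrow> real)"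
      using emeasure_compact_finite[OF C(1)] borel_compact[OF C(1)]
      by (simp add: integrable_indicator_iff)
    moreover have "integrable lebesgue (\<lambda>x. \<bar>a x\<bar> powr p)"
      using a by (simp add: in_Lp_def lebesgue_on_UNIV_eq)
    ultimately show ?thesis by (intro integrable_mult_right Bochner_Integration.integrable_add)
  qed
  then have dom: "integrable (lebesgue_on \<Omega>) (\<lambda>x. M' * (indicator C x + \<bar>a x\<bar> powr p))"
    using integrable_mult_indicator[of \<Omega> lebesgue "\<lambda>x. M' * (indicator C x + \<bar>a x\<bar> powr p)"] \<Omega>
    by (subst integrable_restrict_space) simp_all
  have bound: "AE x in lebesgue_on \<Omega>. norm (K x / v x powr \<gamma> * \<phi> x) \<le> norm (M' * (indicator C x + \<bar>a x\<bar> powr p))"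
    using ae
  proof eventually_elim
    case (elim x)
    show ?case
    proof (cases "\<phi> x = 0")
      case False
      with elim have x: "x \<in> C" "c \<le> v x" "0 \<le> K x" "K x \<le> M" using KC K(2) by auto
      have "K x / v x powr \<gamma> \<le> max M 0 / c powr \<gamma>"
        using x c(1) \<gamma> by (intro frac_le powr_mono2) auto
      moreover have "\<phi> x \<le> indicator C x + \<bar>a x\<bar> powr p"
      proof (cases "\<bar>a x\<bar> \<le> 1")
        case True
        then show ?thesis using x elim by (simp add: add_increasing2)
      next
        case False
        then have "\<bar>a x\<bar> powr 1 \<le> \<bar>a x\<bar> powr p" using p by (intro powr_mono) auto
        then show ?thesis using x elim False by simp
      qed
      ultimately have "K x / v x powr \<gamma> * \<phi> x \<le> M' * (indicator C x + \<bar>a x\<bar> powr p)"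
        unfolding M'_def using x elim by (intro mult_mono) auto
      then show ?thesis using x elim M' by simp
    qed (use M' in simp)
  qed
  have int: "integrable (lebesgue_on \<Omega>) (\<lambda>x. K x / v x powr \<gamma> * \<phi> x)"
    by (rule Bochner_Integration.integrable_bound[OF dom _ bound])
      (intro borel_measurable_times borel_measurable_divide powr_real_measurable K(1) meas
        borel_measurable_const)
  show ?thesis
    unfolding singular_term_def
  \<comment> \<open>Integrability is supplied for the \<open>v\<close> side only: should the
    \<open>u\<close> side fail to be integrable, its default value 0 would still lie below the
    integral of a nonnegative function.\<close>
  proof (rule integral_mono_AE'[OF int])
    show "AE x in lebesgue_on \<Omega>. K x / u x powr \<gamma> * \<phi> x \<le> K x / v x powr \<gamma> * \<phi> x"
      using ae
    proof eventually_elim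
      case (elim x)
      show ?case
      proof (cases "\<phi> x = 0")
        case False
        with elim c(1) K(2) have x: "0 < v x" "v x \<le> u x" "0 \<le> K x" by auto
        have "K x / u x powr \<gamma> \<le> K x / v x powr \<gamma>"
          using x \<gamma> by (intro divide_left_mono powr_mono2 mult_pos_pos) auto
        then show ?thesis using elim by (intro mult_right_mono) auto
      qed simp
    qed
    show "AE x in lebesgue_on \<Omega>. 0 \<le> K x / v x powr \<gamma> * \<phi> x"
      using ae by eventually_elim (use K(2) in auto)
  qed
qed

section \<open>Comparison\<close>

text \<open>With the compactly supported \<phi> in both weak inequalities, the two forms are
  separated by the singular terms, which are ordered because \<open>v \<le> u\<close> wherever
  \<phi> is nonzero. Integrability of both integrands is recorded so that the forms may be
  subtracted.\<close>

lemma weak_comparison_step: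
  fixes \<Omega> :: "'a::euclidean_space set" and a :: "'a \<Rightarrow> real"
  assumes \<Omega>: "open \<Omega>" "bounded \<Omega>" and s: "0 < s" and p: "1 < p" and \<gamma>: "0 \<le> \<gamma>"
    and K: "K \<in> borel_measurable (lebesgue_on \<Omega>)" "\<And>x. x \<in> \<Omega> \<Longrightarrow> 0 \<le> K x"
    and KC: "\<And>x. x \<in> C \<Longrightarrow> K x \<le> M"
    and u: "weak_subsolution s p \<gamma> K \<Omega> u" and v: "weak_supersolution s p \<gamma> K \<Omega> v"
    and e: "0 < e"
    and a: "a \<in> borel_measurable lebesgue" "gagliardo s p UNIV a < \<infinity>"
      "\<And>x. 0 \<le> a x" "\<And>x. a x \<le> max (u x - e) 0"
    and C: "compact C" "C \<subseteq> \<Omega>" "\<And>x. x \<notin> C \<Longrightarrow> a x = 0"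
  defines "\<phi> \<equiv> \<lambda>x. max (a x - v x) 0"
  shows "integrable lebesgue (weak_integrand s p u \<phi>)" "integrable lebesgue (weak_integrand s p v \<phi>)"
    "(\<integral>z. weak_integrand s p u \<phi> z \<partial>lebesgue) \<le> (\<integral>z. weak_integrand s p v \<phi> z \<partial>lebesgue)"
proof -
  have adm: "admissible s p \<Omega> u" "admissible s p \<Omega> v"
    using u v by (auto simp: weak_subsolution_def weak_supersolution_def)
  note mu [measurable] = admissible_measurable[OF \<Omega>(1) adm(1)]
  note mv [measurable] = admissible_measurable[OF \<Omega>(1) adm(2)]
  note ma [measurable] = a(1)
  note nnu = admissible_AE_nonneg[OF \<Omega>(1) adm(1)]
  note nnv = admissible_AE_nonneg[OF \<Omega>(1) adm(2)]
  have m\<phi>: "\<phi> \<in> borel_measurable lebesgue" unfolding \<phi>_def by measurable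
  obtain A A' \<eta> where A: "open A" "open A'" "compactly_contained A \<Omega>" "compactly_contained A' \<Omega>"
    "C \<subseteq> A" "A \<subseteq> A'" "0 < \<eta>" "\<forall>x\<in>A. ball x \<eta> \<subseteq> A'"
    by (rule compact_neighbourhoods[OF C(1) \<Omega>(1) C(2)])
  have A\<Omega>: "A \<subseteq> \<Omega>" using A(3) closure_subset[of A] by (auto simp: compactly_contained_def)
  have gu: "gagliardo s p A' u < \<infinity>" and gv: "gagliardo s p A' v < \<infinity>"
    using adm A(2,4) by (auto simp: admissible_def W_sp_loc_def)
  have La: "in_Lp p UNIV a"
  proof -
    have "integrable lebesgue (\<lambda>x. \<bar>max (u x - e) 0\<bar> powr p)"
      using admissible_truncation(1)[OF \<Omega> p adm(1) e] by (simp add: in_Lp_def lebesgue_on_UNIV_eq)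
    then have "integrable lebesgue (\<lambda>x. \<bar>a x\<bar> powr p)"
    proof (rule Bochner_Integration.integrable_bound)
      have "\<bar>a x\<bar> powr p \<le> \<bar>max (u x - e) 0\<bar> powr p" for x
        using a(3,4)[of x] p by (intro powr_mono2) auto
      then show "AE x in lebesgue. norm (\<bar>a x\<bar> powr p) \<le> norm (\<bar>max (u x - e) 0\<bar> powr p)" by simp
    qed measurable
    then show ?thesis using a(1) by (simp add: in_Lp_def lebesgue_on_UNIV_eq)
  qed
  have W: "\<phi> \<in> W_sp_0 s p A"
    unfolding \<phi>_def
  proof (rule W_sp_0_max_diff[where A' = A'])
    show "a x = 0" if "x \<notin> A" for x using that A(5) C(3) by blast
    show "A' \<in> sets lebesgue" using A(2) by simp
  qed (use p La a gv nnv A(6) mv in auto)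
  then have T: "\<phi> \<in> test_space s p \<Omega>" using A by (auto simp: test_space_def)
  have g\<phi>: "gagliardo s p UNIV \<phi> < \<infinity>" using W by (simp add: W_sp_0_def W_sp_def)
  have pos: "AE x in lebesgue. 0 \<le> \<phi> x" by (simp add: \<phi>_def)
  have \<phi>: "AE x in lebesgue. \<phi> x \<noteq> 0 \<longrightarrow> x \<in> C \<and> v x \<le> u x \<and> 0 \<le> v x \<and> e < u x"
    using nnv
  proof eventually_elim
    case (elim x)
    show ?case
      using elim C(3)[of x] a(4)[of x] e
      by (cases "x \<in> C") (auto simp: \<phi>_def max_def split: if_splits)
  qed
  \<comment> \<open>Where \<phi> is nonzero, \<open>u > e\<close>, hence
    \<open>u \<le> 2 * (u - e / 2)\<close>; as \<open>0 \<le> v \<le> u\<close> there, the same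
    function dominates \<open>v\<close>. Truncating at \<open>e / 2\<close> instead of
    \<open>e\<close> creates this room.\<close>
  let ?h = "\<lambda>x. max (u x - e / 2) 0"
  have e2: "0 < e / 2" using e by simp
  note h = admissible_truncation[OF \<Omega> p adm(1) e2]
  have \<Omega>s: "\<Omega> \<in> sets lebesgue" "emeasure lebesgue \<Omega> < \<infinity>"
    using bounded_set_imp_lmeasurable[OF \<Omega>(2)] \<Omega>(1) by (auto simp: fmeasurable_def)
  have u0: "u x = 0" and v0: "v x = 0" and h0: "?h x = 0" if "x \<notin> \<Omega>" for x
    using that adm e by (auto simp: admissible_def)
  have A's: "A' \<in> sets lebesgue" using A(2) by simp
  have \<phi>u: "AE x in lebesgue. \<phi> x \<noteq> 0 \<longrightarrow> x \<in> A \<and> \<bar>u x\<bar> \<le> 2 * \<bar>?h x\<bar>"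
    using \<phi> by eventually_elim (use A(5) e in auto)
  have \<phi>v: "AE x in lebesgue. \<phi> x \<noteq> 0 \<longrightarrow> x \<in> A \<and> \<bar>v x\<bar> \<le> 2 * \<bar>?h x\<bar>"
    using \<phi> by eventually_elim (use A(5) e in auto)
  show "integrable lebesgue (weak_integrand s p u \<phi>)"
    by (rule integrable_weak_integrand[OF p s mu m\<phi> h(3) g\<phi> h(2) gu admissible_Lp[OF \<Omega> p adm(1)]
          \<Omega>s A's A(7) A\<Omega> A(8)[rule_format] u0 h0 \<phi>u])
  show "integrable lebesgue (weak_integrand s p v \<phi>)"
    by (rule integrable_weak_integrand[OF p s mv m\<phi> h(3) g\<phi> h(2) gv admissible_Lp[OF \<Omega> p adm(2)]
          \<Omega>s A's A(7) A\<Omega> A(8)[rule_format] v0 h0 \<phi>v])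
  obtain c where c: "0 < c" "AE x in lebesgue. x \<in> A \<longrightarrow> c \<le> v x"
    using adm(2) A(3) unfolding admissible_def by blast
  have "weak_form s p u \<phi> \<le> singular_term \<Omega> K \<gamma> u \<phi>"
    using u T pos by (auto simp: weak_subsolution_def)
  also have "\<dots> \<le> singular_term \<Omega> K \<gamma> v \<phi>"
  proof (rule singular_term_mono[OF \<Omega>(1) p \<gamma> K C(1,2) KC mv c(1) _ La m\<phi>])
    show "AE x in lebesgue. x \<in> C \<longrightarrow> c \<le> v x" using c(2) by eventually_elim (use A(5) in auto)
    show "AE x in lebesgue. 0 \<le> \<phi> x \<and> \<phi> x \<le> \<bar>a x\<bar> \<and> (\<phi> x \<noteq> 0 \<longrightarrow> x \<in> C \<and> v x \<le> u x)"
      using \<phi> nnv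
    proof eventually_elim
      case (elim x)
      have "0 \<le> \<phi> x" "\<phi> x \<le> \<bar>a x\<bar>" using elim(2) a(3)[of x] by (auto simp: \<phi>_def)
      with elim(1) show ?case by blast
    qed
  qed
  also have "\<dots> \<le> weak_form s p v \<phi>"
    using v T pos by (auto simp: weak_supersolution_def)
  finally show "(\<integral>z. weak_integrand s p u \<phi> z \<partial>lebesgue) \<le> (\<integral>z. weak_integrand s p v \<phi> z \<partial>lebesgue)"
    by (simp add: weak_form_def weak_integrand_def)
qed

text \<open>A pair with \<phi> nonzero at the first point and the second point outside \<Omega>
  violates the equality. These pairs form a null set of measure \<open>S\<close> times that of the
  complement, and the complement of a bounded set is not null.\<close>

lemma AE_zero_of_AE_fst_eq_snd:
  fixes \<phi> :: "'a::euclidean_space \<Rightarrow> real"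
  assumes [measurable]: "\<phi> \<in> borel_measurable lebesgue" and \<Omega>: "bounded \<Omega>" "\<Omega> \<in> sets lebesgue"
    and out: "AE x in lebesgue. x \<notin> \<Omega> \<longrightarrow> \<phi> x = 0" and eq: "AE z in lebesgue. \<phi> (fst z) = \<phi> (snd z)"
  shows "AE x in lebesgue. \<phi> x = 0"
proof -
  define S where "S = {x. \<phi> x \<noteq> 0}"
  have S: "S \<in> sets lebesgue"
    using measurable_sets[OF assms(1), of "- {0}"] by (simp add: S_def vimage_def)
  have inf: "emeasure lebesgue (- \<Omega>) \<noteq> 0"
  proof
    assume "emeasure lebesgue (- \<Omega>) = 0"
    then have "emeasure lebesgue (UNIV :: 'a set) = emeasure lebesgue \<Omega>"
      using emeasure_Un_null_set[of \<Omega> lebesgue "- \<Omega>"] \<Omega>(2)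
      by (simp add: null_sets_def Compl_in_sets_lebesgue)
    moreover have "emeasure lebesgue \<Omega> < \<infinity>"
      using bounded_set_imp_lmeasurable[OF \<Omega>] by (auto simp: fmeasurable_def)
    ultimately show False by simp
  qed
  have "AE z in (lebesgue :: ('a \<times> 'a) measure). indicator S (fst z) * indicator (- \<Omega>) (snd z) = (0 :: ennreal)"
    using eq AE_lebesgue_fst_snd[OF out]
    by eventually_elim (auto simp: S_def indicator_def)
  then have "(\<integral>\<^sup>+z. indicator S (fst z :: 'a) * indicator (- \<Omega>) (snd z :: 'a) \<partial>lebesgue) = (\<integral>\<^sup>+(z :: 'a \<times> 'a). 0 \<partial>lebesgue)"
    by (rule nn_integral_cong_AE)
  moreover have "(\<integral>\<^sup>+z. indicator S (fst z :: 'a) * indicator (- \<Omega>) (snd z :: 'a) \<partial>lebesgue)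
    = emeasure lebesgue S * emeasure lebesgue (- \<Omega>)"
    using S \<Omega>(2) by (subst nn_integral_lebesgue_fst_mult_snd) (auto simp: Compl_in_sets_lebesgue)
  ultimately have "emeasure lebesgue S = 0" using inf by simp
  then have "S \<in> null_sets lebesgue" using S by (simp add: null_sets_def)
  then show ?thesis by (rule AE_I') (simp add: S_def)
qed

lemma Min_translates_tendsto:
  fixes \<psi> :: "'a::real_vector \<Rightarrow> real"
  assumes E: "finite E" "E \<noteq> {}"
    and lim: "\<And>e. e \<in> E \<Longrightarrow> (\<lambda>n. \<psi> (x - t n *\<^sub>R e)) \<longlonglongrightarrow> l"
  shows "(\<lambda>n. Min ((\<lambda>e. \<psi> (x - t n *\<^sub>R e)) ` E)) \<longlonglongrightarrow> l"
proof -
  have "(\<lambda>n. \<Sum>e\<in>E. \<bar>\<psi> (x - t n *\<^sub>R e) - l\<bar>) \<longlonglongrightarrow> (\<Sum>e\<in>E. \<bar>l - l\<bar>)"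
    by (intro tendsto_intros lim)
  then have S: "(\<lambda>n. \<Sum>e\<in>E. \<bar>\<psi> (x - t n *\<^sub>R e) - l\<bar>) \<longlonglongrightarrow> 0" by simp
  have "(\<lambda>n. Min ((\<lambda>e. \<psi> (x - t n *\<^sub>R e)) ` E) - l) \<longlonglongrightarrow> 0"
  proof (rule Lim_null_comparison[OF always_eventually S], rule allI)
    fix n
    have "(\<lambda>e. l) ` E = {l}" using E by auto
    then show "norm (Min ((\<lambda>e. \<psi> (x - t n *\<^sub>R e)) ` E) - l) \<le> (\<Sum>e\<in>E. \<bar>\<psi> (x - t n *\<^sub>R e) - l\<bar>)"
      using abs_Min_image_diff_powr_le[OF E, of 1 "\<lambda>e. \<psi> (x - t n *\<^sub>R e)" "\<lambda>e. l"] by simp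
  qed
  then show ?thesis by (simp add: LIM_zero_iff)
qed

lemma nn_integral_mult_add_sum:
  fixes f :: "'a \<Rightarrow> real" and g :: "'b \<Rightarrow> 'a \<Rightarrow> real"
  assumes f: "f \<in> borel_measurable M" "\<And>z. 0 \<le> f z"
    and g: "\<And>d. g d \<in> borel_measurable M" "\<And>d z. 0 \<le> g d z" and c: "0 \<le> c"
  shows "(\<integral>\<^sup>+z. ennreal (c * (f z + (\<Sum>d\<in>E. g d z))) \<partial>M)
    = ennreal c * ((\<integral>\<^sup>+z. ennreal (f z) \<partial>M) + (\<Sum>d\<in>E. \<integral>\<^sup>+z. ennreal (g d z) \<partial>M))"
proof -
  have m: "(\<lambda>z. ennreal (f z)) \<in> borel_measurable M" "\<And>d. (\<lambda>z. ennreal (g d z)) \<in> borel_measurable M"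
    using f(1) g(1) by (auto intro: measurable_compose[OF _ measurable_ennreal])
  then have m': "(\<lambda>z. \<Sum>d\<in>E. ennreal (g d z)) \<in> borel_measurable M"
    by (intro borel_measurable_sum)
  have "ennreal (c * (f z + (\<Sum>d\<in>E. g d z))) = ennreal c * (ennreal (f z) + (\<Sum>d\<in>E. ennreal (g d z)))" for z
    using f(2) g(2) c by (simp add: ennreal_mult ennreal_plus sum_nonneg)
  then have "(\<integral>\<^sup>+z. ennreal (c * (f z + (\<Sum>d\<in>E. g d z))) \<partial>M)
    = (\<integral>\<^sup>+z. ennreal c * (ennreal (f z) + (\<Sum>d\<in>E. ennreal (g d z))) \<partial>M)" by presburger
  also have "\<dots> = ennreal c * ((\<integral>\<^sup>+z. ennreal (f z) \<partial>M) + (\<Sum>d\<in>E. \<integral>\<^sup>+z. ennreal (g d z) \<partial>M))"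
    by (simp only: nn_integral_cmult[OF borel_measurable_add[OF m(1) m']] nn_integral_add[OF m(1) m']
        nn_integral_sum[OF m(2)])
  finally show ?thesis .
qed

section \<open>Comparison with a positive margin\<close>

lemma comparison_up_to_eps:
  fixes \<Omega> :: "'a::euclidean_space set"
  assumes \<Omega>: "open \<Omega>" "bounded \<Omega>" "C11_boundary \<Omega>" and s: "0 < s" and p: "1 < p" and \<gamma>: "0 \<le> \<gamma>"
    and K: "K \<in> borel_measurable (lebesgue_on \<Omega>)" "\<And>x. x \<in> \<Omega> \<Longrightarrow> 0 \<le> K x"
    and KC: "\<And>C. compact C \<Longrightarrow> C \<subseteq> \<Omega> \<Longrightarrow> \<exists>M. \<forall>x\<in>C. K x \<le> M"
    and u: "weak_subsolution s p \<gamma> K \<Omega> u" and v: "weak_supersolution s p \<gamma> K \<Omega> v"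
    and e: "0 < e"
  shows "AE x in lebesgue. u x \<le> v x + e"
proof -
  have adm: "admissible s p \<Omega> u" "admissible s p \<Omega> v"
    using u v by (auto simp: weak_subsolution_def weak_supersolution_def)
  note mu [measurable] = admissible_measurable[OF \<Omega>(1) adm(1)]
  note mv [measurable] = admissible_measurable[OF \<Omega>(1) adm(2)]
  note nnv = admissible_AE_nonneg[OF \<Omega>(1) adm(2)]
  define \<psi> where "\<psi> x = max (u x - e) 0" for x
  note tr = admissible_truncation[OF \<Omega>(1,2) p adm(1) e, folded \<psi>_def]
  note m\<psi> [measurable] = tr(3)
  have \<psi>0: "0 \<le> \<psi> x" for x by (simp add: \<psi>_def)
  have \<psi>out: "\<psi> x = 0" if "x \<notin> \<Omega>" for x
    using that adm(1) e by (auto simp: admissible_def \<psi>_def)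
  obtain E \<rho> where E: "finite E" "0 \<in> E" "0 < \<rho>"
    "\<forall>t z. 0 < t \<and> t < \<rho> \<and> z \<in> frontier \<Omega> \<longrightarrow> (\<exists>d\<in>E. z - t *\<^sub>R d \<in> interior (- \<Omega>))"
    by (rule frontier_directions[OF \<Omega>])
  have Ene: "E \<noteq> {}" using E(2) by auto
  \<comment> \<open>The summand 2 keeps every shift strictly below \<rho>, including the one with
    index 0.\<close>
  have t0: "(\<lambda>n. \<rho> / real (n + 2)) \<longlonglongrightarrow> 0"
    by (rule LIMSEQ_ignore_initial_segment) (rule lim_const_over_n)
  obtain r where r: "strict_mono r"
    "AE x in lebesgue. \<forall>d\<in>E. (\<lambda>n. \<psi> (x - (\<rho> / real (r n + 2)) *\<^sub>R d)) \<longlonglongrightarrow> \<psi> x"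
    using AE_translate_subseq[OF m\<psi> \<psi>out \<Omega>(2) t0 E(1)] by blast
  define t where "t n = \<rho> / real (r n + 2)" for n
  have t: "0 < t n" "t n < \<rho>" for n
    using E(3) mult_strict_left_mono[of 1 "real (r n + 2)" \<rho>]
    by (simp_all add: t_def divide_less_eq)
  have conv: "AE x in lebesgue. \<forall>d\<in>E. (\<lambda>n. \<psi> (x - t n *\<^sub>R d)) \<longlonglongrightarrow> \<psi> x"
    using r(2) by (simp add: t_def)
  define a where "a n x = Min ((\<lambda>d. \<psi> (x - t n *\<^sub>R d)) ` E)" for n x
  define \<phi> where "\<phi> n x = max (a n x - v x) 0" for n x
  define I where "I n z = weak_integrand s p u (\<phi> n) z - weak_integrand s p v (\<phi> n) z" for n z
  define G where "G n z = 4 * (energy_density s p \<psi> z + (\<Sum>d\<in>E. energy_density s p (\<lambda>x. \<psi> (x - t n *\<^sub>R d)) z))" for n z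
  define \<phi>\<^sub>0 where "\<phi>\<^sub>0 x = max (\<psi> x - v x) 0" for x
  define I\<^sub>0 where "I\<^sub>0 z = weak_integrand s p u \<phi>\<^sub>0 z - weak_integrand s p v \<phi>\<^sub>0 z" for z
  define G\<^sub>0 where "G\<^sub>0 z = 4 * (energy_density s p \<psi> z + (\<Sum>d\<in>E. energy_density s p \<psi> z))" for z
  have ma [measurable]: "a n \<in> borel_measurable lebesgue" for n
    unfolding a_def using E(1) translate_lebesgue_measurable[OF m\<psi>] by (intro borel_measurable_Min) auto
  have m\<phi> [measurable]: "\<phi> n \<in> borel_measurable lebesgue" for n
    unfolding \<phi>_def by measurable
  have m\<phi>0 [measurable]: "\<phi>\<^sub>0 \<in> borel_measurable lebesgue"
    unfolding \<phi>\<^sub>0_def by measurable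
  have mI0 [measurable]: "I\<^sub>0 \<in> borel_measurable lebesgue"
    unfolding I\<^sub>0_def[abs_def] by (intro borel_measurable_diff weak_integrand_measurable mu mv m\<phi>0)
  have mI [measurable]: "I n \<in> borel_measurable lebesgue" for n
    unfolding I_def[abs_def] by (intro borel_measurable_diff weak_integrand_measurable mu mv m\<phi>)
  have mt [measurable]: "energy_density s p (\<lambda>x. \<psi> (x - t n *\<^sub>R d)) \<in> borel_measurable lebesgue" for n d
    by (rule energy_density_measurable[OF translate_lebesgue_measurable[OF m\<psi>]])
  have me [measurable]: "energy_density s p \<psi> \<in> borel_measurable lebesgue"
    by (rule energy_density_measurable[OF m\<psi>])
  have mG [measurable]: "G n \<in> borel_measurable lebesgue" for n
    unfolding G_def[abs_def] by (intro borel_measurable_times borel_measurable_const borel_measurable_add borel_measurable_sum me mt)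
  have mG0 [measurable]: "G\<^sub>0 \<in> borel_measurable lebesgue"
    unfolding G\<^sub>0_def[abs_def] by (intro borel_measurable_times borel_measurable_const borel_measurable_add borel_measurable_sum me)
  have G0: "0 \<le> G n z" and G\<^sub>00: "0 \<le> G\<^sub>0 z" for n z
    by (simp_all add: G_def G\<^sub>0_def sum_nonneg add_nonneg_nonneg)
  define gg where "gg = gagliardo s p UNIV \<psi>"
  have gg: "gg < \<infinity>" using tr(2) by (simp add: gg_def)
  \<comment> \<open>By translation invariance every \<open>G n\<close> has integral
    \<open>B\<close>, and so has the limit \<open>G\<^sub>0\<close>. This equality lets the
    dominating terms cancel exactly after Fatou's lemma.\<close>
  define B where "B = 4 * (gg + (\<Sum>d\<in>E. gg))"
  have B: "B < \<infinity>" using gg E(1) by (auto simp: B_def ennreal_mult_less_top of_nat_less_top)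
  have intG: "(\<integral>\<^sup>+z. ennreal (G n z) \<partial>lebesgue) = B" for n
    unfolding G_def B_def gg_def
    by (subst nn_integral_mult_add_sum[OF me energy_density_nonneg mt energy_density_nonneg])
      (simp_all only: nn_integral_energy_density_translate[OF m\<psi>] gagliardo_UNIV_eq[symmetric]
        ennreal_numeral zero_le_numeral)
  have intG0: "(\<integral>\<^sup>+z. ennreal (G\<^sub>0 z) \<partial>lebesgue) = B"
    unfolding G\<^sub>0_def B_def gg_def
    by (subst nn_integral_mult_add_sum[OF me energy_density_nonneg me energy_density_nonneg])
      (simp_all only: gagliardo_UNIV_eq[symmetric] ennreal_numeral zero_le_numeral)
  have ga: "gagliardo s p UNIV (a n) < \<infinity>" for n
  proof -
    have "gagliardo s p UNIV (a n) \<le> (\<integral>\<^sup>+z. ennreal (G n z) \<partial>lebesgue)"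
      unfolding gagliardo_UNIV_eq
    proof (intro nn_integral_mono ennreal_leI)
      fix z
      have "energy_density s p (a n) z \<le> (\<Sum>d\<in>E. energy_density s p (\<lambda>x. \<psi> (x - t n *\<^sub>R d)) z)"
        unfolding a_def by (rule energy_density_Min_translates_le[OF E(1) Ene p])
      moreover have "0 \<le> (\<Sum>d\<in>E. energy_density s p (\<lambda>x. \<psi> (x - t n *\<^sub>R d)) z)" by (simp add: sum_nonneg)
      moreover have "0 \<le> energy_density s p \<psi> z" by (rule energy_density_nonneg)
      ultimately show "energy_density s p (a n) z \<le> G n z" unfolding G_def by argo
    qed
    also have "\<dots> < \<infinity>" using intG B by simp
    finally show ?thesis .
  qed
  have a0: "0 \<le> a n x" for n x
    unfolding a_def using E(1) Ene \<psi>0 by (subst Min_ge_iff) auto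
  have a\<psi>: "a n x \<le> \<psi> x" for n x
    unfolding a_def using E(1,2) by (intro Min_le) (auto intro!: image_eqI[of _ _ 0])
  have step: "integrable lebesgue (I n)" "(\<integral>z. I n z \<partial>lebesgue) \<le> 0" for n
  proof -
    have out: "\<exists>d\<in>E. z - t n *\<^sub>R d \<in> interior (- \<Omega>)" if "z \<in> frontier \<Omega>" for z
      using E(4) t[of n] that by blast
    have "\<exists>C. compact C \<and> C \<subseteq> \<Omega> \<and> (\<forall>x. x \<notin> C \<longrightarrow> a n x = 0)"
      unfolding a_def by (rule Min_translates_compact_support[OF \<Omega>(2) E(1,2) out \<psi>0 \<psi>out])
    then obtain C where C: "compact C" "C \<subseteq> \<Omega>" "\<forall>x. x \<notin> C \<longrightarrow> a n x = 0" by auto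
    from KC[OF C(1,2)] obtain M where M: "\<forall>x\<in>C. K x \<le> M" by auto
    note st = weak_comparison_step[OF \<Omega>(1,2) s p \<gamma> K M[rule_format] u v e ma[of n] ga[of n] a0[of n]
        a\<psi>[of n, unfolded \<psi>_def] C(1,2) C(3)[rule_format]]
    show "integrable lebesgue (I n)"
      unfolding I_def \<phi>_def by (intro Bochner_Integration.integrable_diff st)
    show "(\<integral>z. I n z \<partial>lebesgue) \<le> 0"
      unfolding I_def \<phi>_def using st by (simp add: Bochner_Integration.integral_diff)
  qed
  \<comment> \<open>The pointwise lower bound involves the energy density of \<open>a n\<close>,
    which is replaced by the sum over the translates contained in \<open>G n\<close>.\<close>
  have lower: "AE z in lebesgue. 0 \<le> I n z + G n z" for n
    using AE_lebesgue_fst_snd[OF nnv]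
  proof eventually_elim
    case (elim z)
    obtain x y where z: "z = (x, y)" by fastforce
    let ?k = "norm (x - y) powr (real DIM('a) + s * p)"
    have "- 4 * (\<bar>\<psi> x - \<psi> y\<bar> powr p + \<bar>a n x - a n y\<bar> powr p)
      \<le> (sgn_pow p (u x - u y) - sgn_pow p (v x - v y)) * (\<phi> n x - \<phi> n y)"
      unfolding \<phi>_def \<psi>_def
      using elim z a0[of n x] a0[of n y] a\<psi>[of n x] a\<psi>[of n y]
      by (intro sgn_pow_diff_mult_lower_bound p e) (auto simp: \<psi>_def)
    then have "- 4 * (\<bar>\<psi> x - \<psi> y\<bar> powr p + \<bar>a n x - a n y\<bar> powr p) / ?k
      \<le> (sgn_pow p (u x - u y) - sgn_pow p (v x - v y)) * (\<phi> n x - \<phi> n y) / ?k"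
      by (rule divide_right_mono) simp
    also have "\<dots> = I n z"
      by (simp add: I_def weak_integrand_def z left_diff_distrib diff_divide_distrib)
    also have "- 4 * (\<bar>\<psi> x - \<psi> y\<bar> powr p + \<bar>a n x - a n y\<bar> powr p) / ?k
      = - 4 * (energy_density s p \<psi> z + energy_density s p (a n) z)"
      by (simp add: energy_density_def z add_divide_distrib diff_divide_distrib)
    finally have "- 4 * (energy_density s p \<psi> z + energy_density s p (a n) z) \<le> I n z" .
    moreover have "energy_density s p (a n) z \<le> (\<Sum>d\<in>E. energy_density s p (\<lambda>x. \<psi> (x - t n *\<^sub>R d)) z)"
      unfolding a_def by (rule energy_density_Min_translates_le[OF E(1) Ene p])
    ultimately show ?case unfolding G_def by argo
  qed
  have bound: "(\<integral>\<^sup>+z. ennreal (I n z + G n z) \<partial>lebesgue) \<le> B" for n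
  proof -
    have iG: "integrable lebesgue (G n)"
      using intG[of n] B G0 by (intro integrableI_bounded) auto
    have "(\<integral>\<^sup>+z. ennreal (I n z + G n z) \<partial>lebesgue) = ennreal (\<integral>z. I n z + G n z \<partial>lebesgue)"
      using lower by (intro nn_integral_eq_integral Bochner_Integration.integrable_add step iG)
    also have "\<dots> \<le> ennreal (\<integral>z. G n z \<partial>lebesgue)"
      using step iG by (intro ennreal_leI) (simp add: Bochner_Integration.integral_add)
    also have "\<dots> = B"
      using nn_integral_eq_integral[OF iG] G0 intG[of n] by simp
    finally show ?thesis .
  qed
  have I\<^sub>0pos: "AE z in lebesgue. 0 \<le> I\<^sub>0 z \<and> (I\<^sub>0 z = 0 \<longrightarrow> \<phi>\<^sub>0 (fst z) = \<phi>\<^sub>0 (snd z))"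
    using AE_lebesgue_fst_snd[OF nnv]
  proof eventually_elim
    case (elim z)
    obtain x y where z: "z = (x, y)" by fastforce
    let ?k = "norm (x - y) powr (real DIM('a) + s * p)"
    \<comment> \<open>Since \<open>v\<close> is nonnegative, the inner truncation of
      \<open>u - e\<close> at 0 does not affect the outer one.\<close>
    have \<phi>: "\<phi>\<^sub>0 x = max (u x - v x - e) 0" "\<phi>\<^sub>0 y = max (u y - v y - e) 0"
      using elim z by (auto simp: \<phi>\<^sub>0_def \<psi>_def)
    have I: "I\<^sub>0 z = (sgn_pow p (u x - u y) - sgn_pow p (v x - v y)) * (\<phi>\<^sub>0 x - \<phi>\<^sub>0 y) / ?k"
      by (simp add: I\<^sub>0_def weak_integrand_def z left_diff_distrib diff_divide_distrib)
    note pos = sgn_pow_diff_mult_pos[OF p, where ?u1.0 = "u x" and ?u2.0 = "u y" and ?v1.0 = "v x" and ?v2.0 = "v y" and c = e,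
        folded \<phi>]
    have "0 \<le> I\<^sub>0 z" unfolding I using pos(1) by simp
    moreover have "\<phi>\<^sub>0 x = \<phi>\<^sub>0 y" if "I\<^sub>0 z = 0"
    proof (rule ccontr)
      assume ne: "\<phi>\<^sub>0 x \<noteq> \<phi>\<^sub>0 y"
      \<comment> \<open>On the diagonal the quotient is 0 by division by zero, but there
        \<open>\<phi>\<^sub>0\<close> trivially agrees; off the diagonal the denominator is
        positive.\<close>
      then have "x \<noteq> y" by auto
      then have "0 < ?k" by simp
      then have "0 < I\<^sub>0 z" unfolding I using pos(2)[OF ne] by simp
      with that show False by simp
    qed
    ultimately show ?case by (simp add: z)
  qed
  have lim: "AE z in lebesgue. (\<lambda>n. ennreal (I n z + G n z)) \<longlonglongrightarrow> ennreal (I\<^sub>0 z + G\<^sub>0 z)"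
    using AE_lebesgue_fst_snd[OF conv]
  proof eventually_elim
    case (elim z)
    have lima: "(\<lambda>n. a n (fst z)) \<longlonglongrightarrow> \<psi> (fst z)" "(\<lambda>n. a n (snd z)) \<longlonglongrightarrow> \<psi> (snd z)"
      unfolding a_def using elim by (intro Min_translates_tendsto E(1) Ene; blast)+
    have lim\<phi>: "(\<lambda>n. \<phi> n (fst z)) \<longlonglongrightarrow> \<phi>\<^sub>0 (fst z)" "(\<lambda>n. \<phi> n (snd z)) \<longlonglongrightarrow> \<phi>\<^sub>0 (snd z)"
      unfolding \<phi>_def \<phi>\<^sub>0_def by (intro tendsto_intros lima)+
    have 1: "(\<lambda>n. I n z) \<longlonglongrightarrow> I\<^sub>0 z"
      unfolding I_def I\<^sub>0_def weak_integrand_def divide_inverse by (intro tendsto_intros lim\<phi>)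
    have ed: "(\<lambda>n. energy_density s p (\<lambda>x. \<psi> (x - t n *\<^sub>R d)) z) \<longlonglongrightarrow> energy_density s p \<psi> z" if "d \<in> E" for d
    proof -
      have "(\<lambda>n. \<bar>\<psi> (fst z - t n *\<^sub>R d) - \<psi> (snd z - t n *\<^sub>R d)\<bar> powr p) \<longlonglongrightarrow> \<bar>\<psi> (fst z) - \<psi> (snd z)\<bar> powr p"
        \<comment> \<open>The positive exponent makes \<open>powr\<close> continuous even where the
          base tends to 0.\<close>
        using elim that p by (intro tendsto_powr' tendsto_intros) auto
      then show ?thesis unfolding energy_density_def divide_inverse by (rule tendsto_mult[OF _ tendsto_const])
    qed
    have 2: "(\<lambda>n. G n z) \<longlonglongrightarrow> G\<^sub>0 z"
      unfolding G_def G\<^sub>0_def by (intro tendsto_intros ed)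
    show ?case by (intro tendsto_ennrealI tendsto_add 1 2)
  qed
  \<comment> \<open>Fatou's lemma for \<open>I n + G n\<close>, whose integrals are at most
    \<open>B\<close> because those of \<open>I n\<close> are nonpositive. Cancelling the finite
    \<open>B\<close> leaves integral 0 for \<open>I\<^sub>0\<close>.\<close>
  have "(\<integral>\<^sup>+z. ennreal (I\<^sub>0 z) \<partial>lebesgue) + B = (\<integral>\<^sup>+z. ennreal (I\<^sub>0 z) + ennreal (G\<^sub>0 z) \<partial>lebesgue)"
    by (subst nn_integral_add) (simp_all add: intG0)
  also have "\<dots> = (\<integral>\<^sup>+z. liminf (\<lambda>n. ennreal (I n z + G n z)) \<partial>lebesgue)"
  proof (rule nn_integral_cong_AE)
    show "AE z in lebesgue. ennreal (I\<^sub>0 z) + ennreal (G\<^sub>0 z) = liminf (\<lambda>n. ennreal (I n z + G n z))"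
      using lim I\<^sub>0pos by eventually_elim (simp add: lim_imp_Liminf G\<^sub>00 ennreal_plus)
  qed
  also have "\<dots> \<le> liminf (\<lambda>n. \<integral>\<^sup>+z. ennreal (I n z + G n z) \<partial>lebesgue)"
    by (rule nn_integral_liminf) measurable
  also have "\<dots> \<le> B"
    using Liminf_mono[of "\<lambda>n. \<integral>\<^sup>+z. ennreal (I n z + G n z) \<partial>lebesgue" "\<lambda>n. B" sequentially] bound
    by (simp add: Liminf_const)
  finally have "(\<integral>\<^sup>+z. ennreal (I\<^sub>0 z) \<partial>lebesgue) + B \<le> 0 + B" by simp
  then have "(\<integral>\<^sup>+z. ennreal (I\<^sub>0 z) \<partial>lebesgue) = 0"
    using B by (subst (asm) ennreal_add_left_cancel_le[of B, unfolded add.commute[of B]]) (auto simp: add.commute)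
  then have "AE z in lebesgue. ennreal (I\<^sub>0 z) = 0"
    by (subst (asm) nn_integral_0_iff_AE) auto
  then have "AE z in lebesgue. \<phi>\<^sub>0 (fst z) = \<phi>\<^sub>0 (snd z)"
    using I\<^sub>0pos by eventually_elim (auto simp: ennreal_eq_0_iff)
  moreover have "AE x in lebesgue. x \<notin> \<Omega> \<longrightarrow> \<phi>\<^sub>0 x = 0"
    using nnv by eventually_elim (auto simp: \<phi>\<^sub>0_def \<psi>out)
  ultimately have "AE x in lebesgue. \<phi>\<^sub>0 x = 0"
    using AE_zero_of_AE_fst_eq_snd[OF m\<phi>0 \<Omega>(2)] \<Omega>(1) by simp
  then show ?thesis
    by eventually_elim (auto simp: \<phi>\<^sub>0_def \<psi>_def max_def split: if_splits)
qed

theorem theorem1p1: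
  fixes \<Omega> :: "'a::euclidean_space set"
    and s p \<gamma> \<delta> C1 C2 :: real
    and K u v :: "'a \<Rightarrow> real"
  assumes "bounded_C11_domain \<Omega>"
    and "0 < s" "s < 1" "1 < p" "0 \<le> \<gamma>"
    and "0 \<le> \<delta>" "\<delta> < s * p" "\<delta> < 1 + s - 1 / p"
    and "K \<in> borel_measurable (lebesgue_on \<Omega>)"
    and "0 < C1" "0 < C2"
    and "\<forall>x\<in>\<Omega>. C1 * infdist x (frontier \<Omega>) powr (- \<delta>) \<le> K x \<and>
               K x \<le> C2 * infdist x (frontier \<Omega>) powr (- \<delta>)"
    and "weak_subsolution s p \<gamma> K \<Omega> u"
    and "weak_supersolution s p \<gamma> K \<Omega> v"
  shows "AE x in lebesgue_on \<Omega>. u x \<le> v x"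
proof -
  have \<Omega>: "open \<Omega>" "bounded \<Omega>" "C11_boundary \<Omega>" "\<Omega> \<noteq> {}"
    using assms(1) by (auto simp: bounded_C11_domain_def)
  have K0: "0 \<le> K x" if "x \<in> \<Omega>" for x
  proof -
    have "0 \<le> C1 * infdist x (frontier \<Omega>) powr (- \<delta>)" using assms(10) by simp
    with assms(12) that show ?thesis by force
  qed
  \<comment> \<open>A nonempty boundary is required because \<open>infdist\<close> to the empty set
    is 0 by convention, so a positive distance could not be inferred.\<close>
  have "\<Omega> \<noteq> UNIV" using \<Omega>(2) not_bounded_UNIV by blast
  then have fr: "frontier \<Omega> \<noteq> {}" using \<Omega>(4) frontier_eq_empty by blast
  \<comment> \<open>On a compact subset of \<Omega> the boundary distance is continuous and nonzero,
    so its power is bounded.\<close>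
  have KC: "\<exists>M. \<forall>x\<in>C. K x \<le> M" if C: "compact C" "C \<subseteq> \<Omega>" for C
  proof -
    have pos: "infdist x (frontier \<Omega>) \<noteq> 0" if "x \<in> C" for x
    proof -
      have "x \<notin> frontier \<Omega>" using that C(2) \<Omega>(1) by (auto simp: frontier_def interior_open)
      then show ?thesis using in_closed_iff_infdist_zero[OF frontier_closed fr, of x] by simp
    qed
    have "continuous_on C (\<lambda>x. C2 * infdist x (frontier \<Omega>) powr (- \<delta>))"
      using pos by (intro continuous_intros) auto
    then have "bounded ((\<lambda>x. C2 * infdist x (frontier \<Omega>) powr (- \<delta>)) ` C)"
      using C(1) compact_continuous_image compact_imp_bounded by blast
    then obtain M where M: "\<And>x. x \<in> C \<Longrightarrow> \<bar>C2 * infdist x (frontier \<Omega>) powr (- \<delta>)\<bar> \<le> M"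
      by (auto simp: bounded_iff)
    have "K x \<le> M" if "x \<in> C" for x
      using M[OF that] assms(12) C(2) that by force
    then show ?thesis by blast
  qed
  \<comment> \<open>The exceptional set depends on the margin; countably many margins tending to 0
    keep the union null.\<close>
  have "AE x in lebesgue. \<forall>n. u x \<le> v x + 1 / real (Suc n)"
    unfolding AE_all_countable
    by (intro allI comparison_up_to_eps[OF \<Omega>(1-3) assms(2,4,5,9) K0 KC assms(13,14)]) auto
  then have "AE x in lebesgue. u x \<le> v x"
  proof eventually_elim
    case (elim x)
    have "(\<lambda>n. v x + 1 / real (Suc n)) \<longlonglongrightarrow> v x + 0"
      by (intro tendsto_intros LIMSEQ_Suc lim_1_over_n)
    then show ?case using elim by (intro LIMSEQ_le_const[where X = "\<lambda>n. v x + 1 / real (Suc n)"]) auto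
  qed
  then show ?thesis
    using \<Omega>(1) by (subst AE_restrict_space_iff) auto
qed

end
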